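(* Let $K$ be a perfect field of characteristic $p>0$, let $A$ be a finitely generated $K$-algebra, and let $\nu$ be an admissible pseudovaluation on $A$, defining $W^\dagger(A)$. Let $\mathbf w_0:W^\dagger(A)\to A$ be the homomorphism $(a_0,a_1,\dots)\mapsto a_0$. Let $f(T)\in W^\dagger(A)[T]$ be a polynomial. Let $a\in A$ be an element such that $f(a)=0$ and $f'(a)$ is a unit in $A$, where $f(a)$ and $f'(a)$ are evaluated after applying $\mathbf w_0$ to the coefficients. Then there is a unique $\alpha\in W^\dagger(A)$ such that $f(\alpha)=0$ and $\alpha\equiv a$ modulo $VW^\dagger(A)$, i.e. $\mathbf w_0(\alpha)=a$.
   Context: Rings are commutative with $1$; $W(-)$ denotes $p$-typical Witt vectors and $V$ is the Verschiebung; $VW^\dagger(A)$ is the kernel of $\mathbf w_0:W^\dagger(A)\to A$. A pseudovaluation on a ring $A$ is a function $\nu:A\to\mathbb R\cup\{\pm\infty\}$ with $\nu(0)=\infty$, $\nu(1)=0$, $\nu(a\pm b)\ge\min\{\nu(a),\nu(b)\}$, and $\nu(ab)\ge\nu(a)+\nu(b)$ whenever $\nu(a),\nu(b)\ne-\infty$. It is proper if it never takes the value $-\infty$, and negative if it is proper and $\nu(a)\le 0$ for all $a\ne 0$. Two functions $\nu_1,\nu_2:A\to\mathbb R\cup\{\infty\}$ are linearly equivalent if there are real numbers $c_1,c_2>0$, $d_1,d_2\ge0$ with $\nu_1(a)\ge c_2\nu_2(a)-d_2$ and $\nu_2(a)\ge c_1\nu_1(a)-d_1$ for all $a\in A$.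 Admissible pseudovaluations on a finitely generated $K$-algebra $A$: give $K$ the trivial valuation ($\mu(c)=0$ for $c\neq0$, $\mu(0)=\infty$). For a surjection of $K$-algebras $\phi:K[T_1,\dots,T_m]\to A$ and real numbers $d_1,\dots,d_m>0$ put $\nu(\sum_k c_kT^k)=\min_k\{\mu(c_k)-k_1d_1-\dots-k_md_m\}$ and $\bar\nu(a)=\sup\{\nu(f): \phi(f)=a\}$. Up to linear equivalence $\bar\nu$ is independent of the choices. A negative pseudovaluation on $A$ is called admissible if it is linearly equivalent to such a $\bar\nu$. Overconvergent Witt vectors: for $\varepsilon>0$ and $\alpha=(a_0,a_1,\dots)\in W(A)$ let $\gamma_\varepsilon(\alpha)=\inf_i\{i+\varepsilon p^{-i}\nu(a_i)\}$. Then $W^\varepsilon(A)=\{\alpha\in W(A):\gamma_\varepsilon(\alpha)\ne-\infty\}$ and $W^\dagger(A)=\bigcup_{\varepsilon>0}W^\varepsilon(A)$. The ring $W^\dagger(A)$ does not depend on the choice of the admissible pseudovaluation. *)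

theory Defs
  imports
    Complex_Main
    "HOL-Library.Poly_Mapping"
    "HOL-Library.Extended_Real"
    "HOL-Computational_Algebra.Computational_Algebra"
begin

section \<open>Multivariate polynomials and algebras\<close>

text \<open>Multivariate polynomials in variables \<open>'x\<close>: finitely supported functions from multi-indices
  to coefficients, with the convolution product of \<^theory>\<open>HOL-Library.Poly_Mapping\<close>.\<close>

type_synonym ('x, 'c) mpoly = "('x \<Rightarrow>\<^sub>0 nat) \<Rightarrow>\<^sub>0 'c"

definition mvar :: "'x \<Rightarrow> ('x, 'c::comm_ring_1) mpoly" where
  "mvar i = Poly_Mapping.single (Poly_Mapping.single i 1) 1"

definition mconst :: "'c \<Rightarrow> ('x, 'c::comm_ring_1) mpoly" where
  "mconst c = Poly_Mapping.single 0 c"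

definition mmon :: "('x \<Rightarrow> 'r::comm_ring_1) \<Rightarrow> ('x \<Rightarrow>\<^sub>0 nat) \<Rightarrow> 'r" where
  "mmon x k = (\<Prod>i\<in>Poly_Mapping.keys k. x i ^ Poly_Mapping.lookup k i)"

definition meval :: "('x \<Rightarrow> 'r::comm_ring_1) \<Rightarrow> ('x, int) mpoly \<Rightarrow> 'r" where
  "meval x P = (\<Sum>k\<in>Poly_Mapping.keys P. of_int (Poly_Mapping.lookup P k) * mmon x k)"

definition is_ring_hom :: "('r::comm_ring_1 \<Rightarrow> 's::comm_ring_1) \<Rightarrow> bool" where
  "is_ring_hom h \<longleftrightarrow> h 1 = 1 \<and> (\<forall>a b. h (a + b) = h a + h b) \<and> (\<forall>a b. h (a * b) = h a * h b)"

text \<open>A \<open>K\<close>-algebra is given by its structure map \<open>\<iota> : K \<rightarrow> A\<close>. The polynomial ring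
  \<open>K[T\<^sub>1, \<dots>, T\<^sub>m]\<close> is the set of polynomials in the variables \<open>0, \<dots>, m - 1\<close>.\<close>

definition mpolys :: "nat \<Rightarrow> (nat, 'c::comm_ring_1) mpoly set" where
  "mpolys m = {P. \<forall>k\<in>Poly_Mapping.keys P. Poly_Mapping.keys k \<subseteq> {..<m}}"

definition presentation ::
  "('k::field \<Rightarrow> 'a::comm_ring_1) \<Rightarrow> nat \<Rightarrow> ((nat, 'k) mpoly \<Rightarrow> 'a) \<Rightarrow> bool" where
  "presentation \<iota> m \<phi> \<longleftrightarrow>
     (\<forall>c. \<phi> (mconst c) = \<iota> c) \<and>
     (\<forall>P\<in>mpolys m. \<forall>Q\<in>mpolys m. \<phi> (P + Q) = \<phi> P + \<phi> Q) \<and>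
     (\<forall>P\<in>mpolys m. \<forall>Q\<in>mpolys m. \<phi> (P * Q) = \<phi> P * \<phi> Q) \<and>
     \<phi> ` mpolys m = UNIV"

definition finitely_generated_algebra :: "('k::field \<Rightarrow> 'a::comm_ring_1) \<Rightarrow> bool" where
  "finitely_generated_algebra \<iota> \<longleftrightarrow> is_ring_hom \<iota> \<and> (\<exists>m \<phi>. presentation \<iota> m \<phi>)"

text \<open>The library's \<^const>\<open>pderiv\<close> is restricted to coefficient rings without zero divisors.\<close>

definition formal_deriv :: "'a::comm_ring_1 poly \<Rightarrow> 'a poly" where
  "formal_deriv f = (\<Sum>i\<le>degree f. monom (of_nat i * coeff f i) (i - 1))"

lemma coeff_formal_deriv: "coeff (formal_deriv f) n = of_nat (Suc n) * coeff f (Suc n)"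
proof -
  have "coeff (formal_deriv f) n = (\<Sum>i\<le>degree f. if i = Suc n then of_nat i * coeff f i else 0)"
    unfolding formal_deriv_def coeff_sum
  proof (rule sum.cong)
    fix i
    show "coeff (monom (of_nat i * coeff f i) (i - 1)) n = (if i = Suc n then of_nat i * coeff f i else 0)"
      by (cases i) auto
  qed simp
  also have "\<dots> = (if Suc n \<le> degree f then of_nat (Suc n) * coeff f (Suc n) else 0)"
    by (subst sum.delta) auto
  also have "\<dots> = of_nat (Suc n) * coeff f (Suc n)"
    by (auto simp: coeff_eq_0 not_le)
  finally show ?thesis .
qed

lemma formal_deriv_eq_pderiv:
  fixes f :: "'a::idom poly"
  shows "formal_deriv f = pderiv f"
  by (rule poly_eqI) (simp only: coeff_formal_deriv coeff_pderiv)


section \<open>Pseudovaluations\<close>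

definition pseudovaluation :: "('a::comm_ring_1 \<Rightarrow> ereal) \<Rightarrow> bool" where
  "pseudovaluation \<nu> \<longleftrightarrow> \<nu> 0 = \<infinity> \<and> \<nu> 1 = 0 \<and>
     (\<forall>a b. \<nu> (a + b) \<ge> min (\<nu> a) (\<nu> b)) \<and>
     (\<forall>a b. \<nu> (a - b) \<ge> min (\<nu> a) (\<nu> b)) \<and>
     (\<forall>a b. \<nu> a \<noteq> - \<infinity> \<longrightarrow> \<nu> b \<noteq> - \<infinity> \<longrightarrow> \<nu> (a * b) \<ge> \<nu> a + \<nu> b)"

definition proper_pseudovaluation :: "('a::comm_ring_1 \<Rightarrow> ereal) \<Rightarrow> bool" where
  "proper_pseudovaluation \<nu> \<longleftrightarrow> pseudovaluation \<nu> \<and> (\<forall>a. \<nu> a \<noteq> - \<infinity>)"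

definition negative_pseudovaluation :: "('a::comm_ring_1 \<Rightarrow> ereal) \<Rightarrow> bool" where
  "negative_pseudovaluation \<nu> \<longleftrightarrow> proper_pseudovaluation \<nu> \<and> (\<forall>a. a \<noteq> 0 \<longrightarrow> \<nu> a \<le> 0)"

definition linearly_equivalent :: "('a \<Rightarrow> ereal) \<Rightarrow> ('a \<Rightarrow> ereal) \<Rightarrow> bool" where
  "linearly_equivalent \<nu>1 \<nu>2 \<longleftrightarrow>
     (\<exists>c1 c2 d1 d2 :: real. c1 > 0 \<and> c2 > 0 \<and> d1 \<ge> 0 \<and> d2 \<ge> 0 \<and>
        (\<forall>a. \<nu>1 a \<ge> ereal c2 * \<nu>2 a - ereal d2 \<and> \<nu>2 a \<ge> ereal c1 * \<nu>1 a - ereal d1))"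

definition trivial_valuation :: "'k::field \<Rightarrow> ereal" where
  "trivial_valuation c = (if c = 0 then \<infinity> else 0)"

text \<open>The infimum is a minimum: all but finitely many terms are \<open>\<infinity>\<close>.\<close>

definition degree_valuation :: "nat \<Rightarrow> (nat \<Rightarrow> real) \<Rightarrow> (nat, 'k::field) mpoly \<Rightarrow> ereal" where
  "degree_valuation m d P =
     (INF k. trivial_valuation (Poly_Mapping.lookup P k)
               - ereal (\<Sum>i<m. real (Poly_Mapping.lookup k i) * d i))"

definition quotient_valuation ::
  "nat \<Rightarrow> ((nat, 'k::field) mpoly \<Rightarrow> 'a) \<Rightarrow> (nat \<Rightarrow> real) \<Rightarrow> 'a \<Rightarrow> ereal" where
  "quotient_valuation m \<phi> d a = (SUP P\<in>{P \<in> mpolys m. \<phi> P = a}. degree_valuation m d P)"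

definition admissible :: "('k::field \<Rightarrow> 'a::comm_ring_1) \<Rightarrow> ('a \<Rightarrow> ereal) \<Rightarrow> bool" where
  "admissible \<iota> \<nu> \<longleftrightarrow> negative_pseudovaluation \<nu> \<and>
     (\<exists>m \<phi> d. presentation \<iota> m \<phi> \<and> (\<forall>i<m. d i > 0) \<and>
        linearly_equivalent \<nu> (quotient_valuation m \<phi> d))"


section \<open>Universal Witt polynomials\<close>

definition ghost :: "nat \<Rightarrow> nat \<Rightarrow> (nat \<Rightarrow> 'r::comm_ring_1) \<Rightarrow> 'r" where
  "ghost p n x = (\<Sum>i\<le>n. of_nat p ^ i * x i ^ (p ^ (n - i)))"

text \<open>The two families of variables \<open>X\<^sub>i\<close> and \<open>Y\<^sub>i\<close> are \<open>mvar (Inl i)\<close> and \<open>mvar (Inr i)\<close>. For an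
  operation \<open>\<Phi>\<close>, \<open>witt_op p \<Phi>\<close> is the sequence of integral polynomials \<open>s\<^sub>n\<close> with
  \<open>w\<^sub>n(s\<^sub>0, s\<^sub>1, \<dots>) = \<Phi> (w\<^sub>n(X)) (w\<^sub>n(Y))\<close> for all \<open>n\<close>; for prime \<open>p\<close> and the ring operations, existence
  is proved in \<open>dwork_existence\<close> and uniqueness in \<open>ghost_inj\<close> below.\<close>

definition witt_op ::
  "nat \<Rightarrow> ((nat + nat, int) mpoly \<Rightarrow> (nat + nat, int) mpoly \<Rightarrow> (nat + nat, int) mpoly)
     \<Rightarrow> nat \<Rightarrow> (nat + nat, int) mpoly" where
  "witt_op p \<Phi> = (THE s. \<forall>n. ghost p n s =
      \<Phi> (ghost p n (\<lambda>i. mvar (Inl i))) (ghost p n (\<lambda>i. mvar (Inr i))))"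

definition weval :: "(nat \<Rightarrow> (nat + nat, int) mpoly) \<Rightarrow> (nat \<Rightarrow> 'r::comm_ring_1) \<Rightarrow> (nat \<Rightarrow> 'r) \<Rightarrow> nat \<Rightarrow> 'r"
  where "weval s x y n = meval (case_sum x y) (s n)"

subsection \<open>Evaluation\<close>

lemma mmon_superset:
  assumes "finite S" "Poly_Mapping.keys k \<subseteq> S"
  shows "mmon x k = (\<Prod>i\<in>S. x i ^ Poly_Mapping.lookup k i)"
  unfolding mmon_def
  by (rule prod.mono_neutral_left) (use assms in \<open>auto simp: in_keys_iff\<close>)

lemma mmon_0 [simp]: "mmon x 0 = 1"
  by (simp add: mmon_def)

lemma mmon_add: "mmon x (k + l) = mmon x k * mmon x l"
proof -
  let ?S = "Poly_Mapping.keys k \<union> Poly_Mapping.keys l"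
  have "mmon x (k + l) = (\<Prod>i\<in>?S. x i ^ Poly_Mapping.lookup (k + l) i)"
    by (rule mmon_superset) (simp_all add: Poly_Mapping.keys_add)
  also have "\<dots> = (\<Prod>i\<in>?S. x i ^ Poly_Mapping.lookup k i) * (\<Prod>i\<in>?S. x i ^ Poly_Mapping.lookup l i)"
    by (simp add: lookup_add power_add prod.distrib)
  also have "\<dots> = mmon x k * mmon x l"
    using mmon_superset[of ?S k x] mmon_superset[of ?S l x] by simp
  finally show ?thesis .
qed

lemma meval_superset:
  assumes "finite S" "Poly_Mapping.keys P \<subseteq> S"
  shows "meval x P = (\<Sum>k\<in>S. of_int (Poly_Mapping.lookup P k) * mmon x k)"
  unfolding meval_def
  by (rule sum.mono_neutral_left) (use assms in \<open>auto simp: in_keys_iff\<close>)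

lemma meval_0 [simp]: "meval x 0 = 0"
  by (simp add: meval_def)

lemma meval_single: "meval x (Poly_Mapping.single k c) = of_int c * mmon x k"
  by (simp add: meval_def)

lemma meval_1 [simp]: "meval x 1 = 1"
  using meval_single[of x 0 1] by simp

lemma meval_mvar [simp]: "meval x (mvar i) = x i"
  by (simp add: mvar_def meval_single mmon_def)

lemma meval_add: "meval x (P + Q) = meval x P + meval x Q"
proof -
  let ?S = "Poly_Mapping.keys P \<union> Poly_Mapping.keys Q"
  have "meval x (P + Q) = (\<Sum>k\<in>?S. of_int (Poly_Mapping.lookup (P + Q) k) * mmon x k)"
    by (rule meval_superset) (simp_all add: Poly_Mapping.keys_add)
  also have "\<dots> = (\<Sum>k\<in>?S. of_int (Poly_Mapping.lookup P k) * mmon x k)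
                + (\<Sum>k\<in>?S. of_int (Poly_Mapping.lookup Q k) * mmon x k)"
    by (simp add: lookup_add distrib_right sum.distrib)
  also have "\<dots> = meval x P + meval x Q"
    using meval_superset[of ?S P x] meval_superset[of ?S Q x] by simp
  finally show ?thesis .
qed

lemma meval_diff: "meval x (P - Q) = meval x P - meval x Q"
  using meval_add[of x "P - Q" Q] by simp

lemma meval_mult: "meval x (P * Q) = meval x P * meval x Q"
proof (induction P rule: frag_induction[OF subset_UNIV])
  case (2 k)
  show ?case
  proof (induction Q rule: frag_induction[OF subset_UNIV])
    case (2 l)
    show ?case by (simp add: mult_single meval_single mmon_add)
  next
    case (3 a b)
    then show ?case by (simp add: right_diff_distrib meval_diff)
  qed simp
next
  case (3 a b)
  then show ?case by (simp add: left_diff_distrib meval_diff)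
qed simp

lemma is_ring_hom_meval: "is_ring_hom (meval x)"
  by (simp add: is_ring_hom_def meval_add meval_mult)

context
  fixes h :: "'r::comm_ring_1 \<Rightarrow> 's::comm_ring_1"
  assumes h: "is_ring_hom h"
begin

lemma hom_1: "h 1 = 1"
  and hom_add: "h (a + b) = h a + h b"
  and hom_mult: "h (a * b) = h a * h b"
  using h by (auto simp: is_ring_hom_def)

lemma hom_0: "h 0 = 0"
  using hom_add[of 0 0] by simp

lemma hom_diff: "h (a - b) = h a - h b"
  using hom_add[of "a - b" b] by (simp add: algebra_simps)

lemma hom_uminus: "h (- a) = - h a"
  using hom_diff[of 0 a] by (simp add: hom_0)

lemma hom_power: "h (a ^ n) = h a ^ n"
  by (induction n) (simp_all add: hom_1 hom_mult)

lemma hom_of_nat: "h (of_nat n) = of_nat n"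
  by (induction n) (simp_all add: hom_0 hom_1 hom_add)

lemma hom_of_int: "h (of_int n) = of_int n"
  by (cases n) (simp_all add: hom_of_nat hom_diff hom_1 hom_uminus del: of_nat_Suc)

lemma hom_sum: "h (sum f S) = (\<Sum>i\<in>S. h (f i))"
  by (induction S rule: infinite_finite_induct) (simp_all add: hom_0 hom_add)

lemma hom_prod: "h (prod f S) = (\<Prod>i\<in>S. h (f i))"
  by (induction S rule: infinite_finite_induct) (simp_all add: hom_1 hom_mult)

lemma hom_ghost: "h (ghost p n x) = ghost p n (\<lambda>i. h (x i))"
  by (simp add: ghost_def hom_sum hom_mult hom_power hom_of_nat)

lemma hom_meval: "h (meval x P) = meval (\<lambda>i. h (x i)) P"
  by (simp add: meval_def mmon_def hom_sum hom_mult hom_of_int hom_prod hom_power)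

lemma hom_weval: "h (weval s x y n) = weval s (\<lambda>i. h (x i)) (\<lambda>i. h (y i)) n"
  unfolding weval_def hom_meval by (rule arg_cong[of _ _ "\<lambda>v. meval v (s n)"]) (auto split: sum.split)

end

lemma CHAR_algebra:
  fixes \<iota> :: "'k::field \<Rightarrow> 'a::comm_ring_1"
  assumes "is_ring_hom \<iota>"
  shows "CHAR('a) = CHAR('k)"
proof (rule CHAR_eqI)
  show "of_nat CHAR('k) = (0 :: 'a)"
    using hom_of_nat[OF assms, of "CHAR('k)"] hom_0[OF assms] by simp
next
  fix n assume n: "of_nat n = (0 :: 'a)"
  have "of_nat n = (0 :: 'k)"
  proof (rule ccontr)
    assume "of_nat n \<noteq> (0 :: 'k)"
    then have "\<iota> (of_nat n) * \<iota> (inverse (of_nat n)) = 1"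
      by (simp add: hom_mult[OF assms, symmetric] hom_1[OF assms])
    with n show False by (simp add: hom_of_nat[OF assms])
  qed
  then show "CHAR('k) dvd n" by (simp add: of_nat_eq_0_iff_char_dvd)
qed

subsection \<open>Existence and uniqueness\<close>

lemma freshman_dvd:
  fixes a b :: "'r::comm_ring_1"
  assumes "prime p"
  shows "of_nat p dvd (a + b) ^ p - a ^ p - b ^ p"
proof -
  have p: "p > 0" using assms prime_gt_0_nat by blast
  have "(a + b) ^ p = (\<Sum>k\<le>p. of_nat (p choose k) * a ^ k * b ^ (p - k))"
    by (rule binomial_ring)
  also have "{..p} = insert 0 (insert p {0<..<p})" using p by auto
  also have "(\<Sum>k\<in>\<dots>. of_nat (p choose k) * a ^ k * b ^ (p - k))
     = b ^ p + a ^ p + (\<Sum>k\<in>{0<..<p}. of_nat (p choose k) * a ^ k * b ^ (p - k))"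
    using p by simp
  finally have "(a + b) ^ p - a ^ p - b ^ p =
      (\<Sum>k\<in>{0<..<p}. of_nat (p choose k) * a ^ k * b ^ (p - k))" by simp
  moreover have "of_nat p dvd (\<Sum>k\<in>{0<..<p}. of_nat (p choose k) * a ^ k * b ^ (p - k))"
  proof (rule dvd_sum)
    fix k assume "k \<in> {0<..<p}"
    then have "p dvd p choose k" using assms by (intro dvd_choose_prime) auto
    then have "(of_nat p :: 'r) dvd of_nat (p choose k)" by (auto simp: dvd_def)
    then show "of_nat p dvd of_nat (p choose k) * a ^ k * b ^ (p - k)"
      by (simp add: mult.assoc)
  qed
  ultimately show ?thesis by simp
qed

definition frob_lift :: "nat \<Rightarrow> ('x, int) mpoly \<Rightarrow> ('x, int) mpoly" where
  "frob_lift p = meval (\<lambda>i. mvar i ^ p)"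

lemma mvar_power: "mvar i ^ n = (Poly_Mapping.single (Poly_Mapping.single i n) 1 :: ('x, 'c::comm_ring_1) mpoly)"
  by (induction n) (simp_all add: mvar_def mult_single single_add[symmetric])

lemma single_eq_mmon: "(Poly_Mapping.single k 1 :: ('x, 'c::comm_ring_1) mpoly) = mmon mvar k"
proof (induction k rule: update_induct)
  case const
  then show ?case by simp
next
  case (update f a b)
  have "Poly_Mapping.update a b f = f + Poly_Mapping.single a b"
    using update by (intro poly_mapping_eqI)
      (auto simp: lookup_update lookup_add lookup_single in_keys_iff when_def)
  moreover have "mmon mvar (Poly_Mapping.single a b) = (Poly_Mapping.single (Poly_Mapping.single a b) 1 :: ('x, 'c) mpoly)"
    using update by (simp add: mmon_def mvar_power)
  moreover have "Poly_Mapping.single (f + Poly_Mapping.single a b) 1 =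
      (Poly_Mapping.single f 1 * Poly_Mapping.single (Poly_Mapping.single a b) 1 :: ('x, 'c) mpoly)"
    by (simp add: mult_single)
  ultimately show ?case using update by (simp add: mmon_add)
qed

lemma mmon_power: "mmon (\<lambda>i. x i ^ n) k = mmon x k ^ n"
  by (simp add: mmon_def prod_power_distrib power_mult[symmetric] mult.commute)

lemma frob_lift_dvd:
  assumes "prime p"
  shows "of_nat p dvd P ^ p - frob_lift p P"
proof (induction P rule: frag_induction[OF subset_UNIV])
  case 1
  then show ?case using prime_gt_0_nat[OF assms] by (simp add: frob_lift_def zero_power)
next
  case (2 k)
  have "frob_lift p (Poly_Mapping.single k 1) = Poly_Mapping.single k 1 ^ p"
    unfolding frob_lift_def meval_single mmon_power by (simp add: single_eq_mmon)
  then show ?case by simp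
next
  case (3 a b)
  have "(a - b) ^ p - frob_lift p (a - b) =
     (a ^ p - frob_lift p a) - (b ^ p - frob_lift p b) - (((a - b) + b) ^ p - (a - b) ^ p - b ^ p)"
    by (simp add: frob_lift_def meval_diff)
  also have "of_nat p dvd \<dots>"
    by (rule dvd_diff[OF dvd_diff[OF 3] freshman_dvd[OF assms, of "a - b" b]])
  finally show ?case .
qed

lemma dvd_power_step:
  fixes a b :: "'r::comm_ring_1"
  assumes "of_nat p ^ Suc k dvd a - b"
  shows "of_nat p ^ Suc (Suc k) dvd a ^ p - b ^ p"
proof -
  have pd: "of_nat p dvd a - b"
    using assms by (rule dvd_trans[rotated]) simp
  have eq: "a ^ p - b ^ p = (a - b) * (\<Sum>i<p. b ^ (p - Suc i) * a ^ i)"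
    by (rule power_diff_sumr2)
  have pow: "of_nat p dvd a ^ i - b ^ i" for i
    using pd by (metis dvd_mult2 power_diff_sumr2)
  have "(\<Sum>i<p. b ^ (p - Suc i) * a ^ i) =
     (\<Sum>i<p. b ^ (p - Suc i) * (a ^ i - b ^ i)) + (\<Sum>i<p. b ^ (p - Suc i) * b ^ i)"
    by (simp add: right_diff_distrib sum_subtractf)
  also have "(\<Sum>i<p. b ^ (p - Suc i) * b ^ i) = (\<Sum>i<p. b ^ (p - 1))"
    by (rule sum.cong) (auto simp: power_add[symmetric])
  also have "\<dots> = of_nat p * b ^ (p - 1)" by simp
  finally have "of_nat p dvd (\<Sum>i<p. b ^ (p - Suc i) * a ^ i)"
    using pow by (auto intro!: dvd_add dvd_sum)
  with assms have "of_nat p ^ Suc k * of_nat p dvd a ^ p - b ^ p"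
    unfolding eq by (rule mult_dvd_mono)
  then show ?thesis by (simp add: mult.commute mult.left_commute)
qed

lemma dvd_power_iter:
  fixes a b :: "'r::comm_ring_1"
  assumes "of_nat p dvd a - b"
  shows "of_nat p ^ Suc k dvd a ^ (p ^ k) - b ^ (p ^ k)"
proof (induction k)
  case (Suc k)
  from dvd_power_step[OF this] show ?case
    by (simp add: power_mult[symmetric] mult.commute)
qed (use assms in simp)

definition dwork :: "nat \<Rightarrow> (nat \<Rightarrow> ('x, int) mpoly) \<Rightarrow> bool" where
  "dwork p g \<longleftrightarrow> (\<forall>n. of_nat p ^ Suc n dvd frob_lift p (g n) - g (Suc n))"

lemma ghost_Suc: "ghost p (Suc n) x = ghost p n (\<lambda>i. x i ^ p) + of_nat p ^ Suc n * x (Suc n)"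
proof -
  have "(\<Sum>i\<le>n. of_nat p ^ i * x i ^ (p ^ (Suc n - i))) = ghost p n (\<lambda>i. x i ^ p)"
    unfolding ghost_def by (rule sum.cong) (auto simp: Suc_diff_le power_mult)
  then show ?thesis by (simp add: ghost_def)
qed

lemma dwork_existence:
  assumes "prime p" "dwork p g"
  shows "\<exists>s. \<forall>n. ghost p n s = g n"
proof -
  let ?P = "\<lambda>s n r. (\<Sum>i<n. of_nat p ^ i * s i ^ (p ^ (n - i))) + of_nat p ^ n * r = g n"
  have "\<exists>s. \<forall>n. ?P s n (s n)"
  proof (rule dependent_wellorder_choice)
    fix r :: "('a, int) mpoly" and s s' :: "nat \<Rightarrow> ('a, int) mpoly" and n :: nat
    assume "\<And>i. i < n \<Longrightarrow> s i = s' i"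
    then show "?P s n r = ?P s' n r" by simp
  next
    fix n s assume IH: "\<And>i. i < n \<Longrightarrow> ?P s i (s i)"
    show "\<exists>r. ?P s n r"
    proof (cases n)
      case 0
      then show ?thesis by simp
    next
      case (Suc m)
      have gm: "ghost p m s = g m"
        using IH[of m] Suc by (simp add: ghost_def lessThan_Suc_atMost[symmetric])
      have "of_nat p ^ n dvd ghost p m (\<lambda>i. s i ^ p) - ghost p m (\<lambda>i. frob_lift p (s i))"
        unfolding ghost_def sum_subtractf[symmetric] right_diff_distrib[symmetric]
      proof (rule dvd_sum)
        fix i assume "i \<in> {..m}"
        then have "of_nat p ^ n = (of_nat p ^ i * of_nat p ^ Suc (m - i) :: ('a, int) mpoly)"
          by (simp add: Suc power_add[symmetric] del: power_Suc)
        then show "of_nat p ^ n dvd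
           of_nat p ^ i * ((s i ^ p) ^ p ^ (m - i) - frob_lift p (s i) ^ p ^ (m - i))"
          using dvd_power_iter[OF frob_lift_dvd[OF assms(1)], of "m - i" "s i"]
          by (simp only: mult_dvd_mono dvd_refl)
      qed
      moreover have "ghost p m (\<lambda>i. frob_lift p (s i)) = frob_lift p (g m)"
        unfolding gm[symmetric] frob_lift_def by (simp add: hom_ghost[OF is_ring_hom_meval])
      moreover have "of_nat p ^ n dvd frob_lift p (g m) - g n"
        using assms(2) Suc by (simp add: dwork_def del: power_Suc)
      ultimately have "of_nat p ^ n dvd
          (ghost p m (\<lambda>i. s i ^ p) - frob_lift p (g m)) + (frob_lift p (g m) - g n)"
        by (metis dvd_add)
      then have "of_nat p ^ n dvd g n - ghost p m (\<lambda>i. s i ^ p)"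
        by (subst minus_diff_eq[symmetric], subst dvd_minus_iff) simp
      then obtain r where r: "g n - ghost p m (\<lambda>i. s i ^ p) = of_nat p ^ n * r" ..
      have "(\<Sum>i<n. of_nat p ^ i * s i ^ (p ^ (n - i))) = ghost p m (\<lambda>i. s i ^ p)"
        unfolding ghost_def Suc lessThan_Suc_atMost
        by (rule sum.cong) (auto simp: Suc_diff_le power_mult)
      with r have "?P s n r" by (simp add: algebra_simps)
      then show ?thesis ..
    qed
  qed
  then obtain s where s: "\<And>n. ?P s n (s n)" by blast
  have "ghost p n s = g n" for n
    using s[of n] by (simp add: ghost_def lessThan_Suc_atMost[symmetric])
  then show ?thesis by blast
qed

lemma mpoly_cancel:
  fixes P Q :: "('x, int) mpoly"
  assumes "of_nat n * P = of_nat n * Q" "n > 0"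
  shows "P = Q"
proof (rule poly_mapping_eqI)
  have *: "of_nat n * R = frag_cmul (int n) R" for R :: "('x, int) mpoly"
  proof (induction n)
    case (Suc n)
    then show ?case by (simp add: distrib_right frag_cmul_distrib)
  qed simp
  fix k
  have "int n * Poly_Mapping.lookup P k = int n * Poly_Mapping.lookup Q k"
    using arg_cong[OF assms(1), of "\<lambda>R. Poly_Mapping.lookup R k"] unfolding * by simp
  then show "Poly_Mapping.lookup P k = Poly_Mapping.lookup Q k"
    using assms(2) by simp
qed

lemma ghost_inj:
  fixes s t :: "nat \<Rightarrow> ('x, int) mpoly"
  assumes "p > 0" "\<And>n. ghost p n s = ghost p n t"
  shows "s = t"
proof
  fix n
  show "s n = t n"
  proof (induction n rule: less_induct)
    case (less n)
    have "of_nat p ^ n * s n = of_nat p ^ n * t n"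
      using assms(2)[of n] less by (simp add: ghost_def lessThan_Suc_atMost[symmetric])
    then have "of_nat (p ^ n) * s n = of_nat (p ^ n) * t n" by simp
    then show ?case by (rule mpoly_cancel) (use assms in simp)
  qed
qed

lemma dwork_ghost_mvar: "dwork p (\<lambda>n. ghost p n (\<lambda>i. mvar (f i)))"
  by (auto simp: dwork_def frob_lift_def hom_ghost[OF is_ring_hom_meval] ghost_Suc)

lemma dwork_add: "dwork p g \<Longrightarrow> dwork p h \<Longrightarrow> dwork p (\<lambda>n. g n + h n)"
  unfolding dwork_def frob_lift_def
  by (metis (no_types, lifting) add_diff_add dvd_add meval_add)

lemma dwork_uminus: "dwork p g \<Longrightarrow> dwork p (\<lambda>n. - g n)"
  unfolding dwork_def frob_lift_def hom_uminus[OF is_ring_hom_meval]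
  by (metis dvd_minus_iff minus_diff_minus)

lemma dwork_mult: 
  assumes "dwork p g" "dwork p h" 
  shows "dwork p (\<lambda>n. g n * h n)"
  unfolding dwork_def
proof
  fix n
  have "frob_lift p (g n * h n) - g (Suc n) * h (Suc n) =
     frob_lift p (g n) * (frob_lift p (h n) - h (Suc n)) + (frob_lift p (g n) - g (Suc n)) * h (Suc n)"
    by (simp add: frob_lift_def meval_mult algebra_simps)
  also have "of_nat p ^ Suc n dvd \<dots>"
    using assms unfolding dwork_def by (intro dvd_add dvd_mult dvd_mult2) blast+
  finally show "of_nat p ^ Suc n dvd frob_lift p (g n * h n) - g (Suc n) * h (Suc n)" .
qed

lemma ghost_witt_op:
  assumes "prime p"
    and "dwork p (\<lambda>n. \<Phi> (ghost p n (\<lambda>i. mvar (Inl i))) (ghost p n (\<lambda>i. mvar (Inr i))))"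
  shows "ghost p n (witt_op p \<Phi>) = \<Phi> (ghost p n (\<lambda>i. mvar (Inl i))) (ghost p n (\<lambda>i. mvar (Inr i)))"
proof -
  let ?g = "\<lambda>n. \<Phi> (ghost p n (\<lambda>i. mvar (Inl i))) (ghost p n (\<lambda>i. mvar (Inr i)))"
  have "\<exists>!s. \<forall>n. ghost p n s = ?g n"
  proof (rule ex_ex1I)
    show "\<exists>s. \<forall>n. ghost p n s = ?g n"
      by (rule dwork_existence[OF assms])
    show "s = t" if "\<forall>n. ghost p n s = ?g n" "\<forall>n. ghost p n t = ?g n" for s t
      using that by (intro ghost_inj[OF prime_gt_0_nat[OF assms(1)]]) simp
  qed
  from theI'[OF this] show ?thesis unfolding witt_op_def by blast
qed

context
  fixes p :: nat
  assumes p: "prime p"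
begin

lemma ghost_weval:
  "ghost p n (weval s x y) = meval (case_sum x y) (ghost p n s)"
  unfolding hom_ghost[OF is_ring_hom_meval] weval_def ..

lemma ghost_add: "ghost p n (weval (witt_op p (+)) x y) = ghost p n x + ghost p n y"
  unfolding ghost_weval
  by (subst ghost_witt_op[OF p])
     (simp_all add: dwork_add dwork_ghost_mvar meval_add hom_ghost[OF is_ring_hom_meval])

lemma ghost_mult: "ghost p n (weval (witt_op p (*)) x y) = ghost p n x * ghost p n y"
  unfolding ghost_weval
  by (subst ghost_witt_op[OF p])
     (simp_all add: dwork_mult dwork_ghost_mvar meval_mult hom_ghost[OF is_ring_hom_meval])

lemma ghost_uminus: "ghost p n (weval (witt_op p (\<lambda>X Y. - X)) x y) = - ghost p n x"
  unfolding ghost_weval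
  by (subst ghost_witt_op[OF p])
     (simp_all add: dwork_uminus dwork_ghost_mvar hom_uminus[OF is_ring_hom_meval] hom_ghost[OF is_ring_hom_meval])

end

lemma ghost_zero: "p > 0 \<Longrightarrow> ghost p n (\<lambda>_. 0) = 0"
  by (simp add: ghost_def zero_power)

lemma ghost_one: 
  assumes "p > 0"
  shows "ghost p n (\<lambda>i. if i = 0 then 1 else 0) = 1"
proof -
  have "ghost p n (\<lambda>i. if i = 0 then 1 else 0 :: 'a) = (\<Sum>i\<le>n. if i = 0 then 1 else 0)"
    unfolding ghost_def by (rule sum.cong) (use assms in \<open>auto simp: zero_power\<close>)
  then show ?thesis by simp
qed

text \<open>An identity between the components of Witt vectors holds in every ring once it holds for three
  generic vectors over a polynomial ring, where it may be checked on ghost components.\<close>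

definition gen :: "nat \<Rightarrow> nat \<Rightarrow> (nat \<times> nat, int) mpoly" where
  "gen j i = mvar (j, i)"

definition spec :: "(nat \<Rightarrow> 'r::comm_ring_1) \<Rightarrow> (nat \<Rightarrow> 'r) \<Rightarrow> (nat \<Rightarrow> 'r) \<Rightarrow> (nat \<times> nat, int) mpoly \<Rightarrow> 'r" where
  "spec x y z = meval (\<lambda>(j, i). if j = 0 then x i else if j = 1 then y i else z i)"

lemma spec_gen: 
  "(\<lambda>i. spec x y z (gen 0 i)) = x"
  "(\<lambda>i. spec x y z (gen 1 i)) = y"
  "(\<lambda>i. spec x y z (gen 2 i)) = z"
  by (simp_all add: spec_def gen_def)

lemma hom_weval': "is_ring_hom h \<Longrightarrow> (\<lambda>n. h (weval s u v n)) = weval s (\<lambda>i. h (u i)) (\<lambda>i. h (v i))"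
  by (rule ext) (rule hom_weval)

lemma is_ring_hom_spec: "is_ring_hom (spec x y z)"
  unfolding spec_def by (rule is_ring_hom_meval)

lemma spec_const: "(\<lambda>i. spec x y z 0) = (\<lambda>i. 0)"
  "(\<lambda>i. spec x y z (if i = 0 then 1 else 0)) = (\<lambda>i. if i = (0::nat) then 1 else 0)"
  by (auto simp: hom_0[OF is_ring_hom_spec] hom_1[OF is_ring_hom_spec])

lemmas spec_simps = hom_weval'[OF is_ring_hom_spec] spec_gen spec_const

context
  fixes p :: nat
  assumes p: "prime p"
begin

lemma witt_identity:
  assumes "\<And>n. ghost p n u = ghost p n v"
  shows "(\<lambda>i. spec x y z (u i)) = (\<lambda>i. spec x y z (v i))"
  using ghost_inj[OF prime_gt_0_nat[OF p] assms] by simp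

lemmas ghost_simps = ghost_add[OF p] ghost_mult[OF p] ghost_uminus[OF p]
  ghost_zero[OF prime_gt_0_nat[OF p]] ghost_one[OF prime_gt_0_nat[OF p]]

abbreviation (input) "wadd \<equiv> weval (witt_op p (+))"
abbreviation (input) "wmul \<equiv> weval (witt_op p (*))"
abbreviation (input) "wneg \<equiv> weval (witt_op p (\<lambda>X Y. - X))"
abbreviation (input) "wzero \<equiv> (\<lambda>i::nat. 0)"
abbreviation (input) "wone \<equiv> (\<lambda>i::nat. if i = 0 then 1 else 0)"

lemma wadd_commute: "wadd x y = wadd y x"
  using witt_identity[of "wadd (gen 0) (gen 1)" "wadd (gen 1) (gen 0)" x y x, unfolded spec_simps]
  by (simp add: ghost_simps)

lemma wadd_assoc: "wadd (wadd x y) z = wadd x (wadd y z)"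
  using witt_identity[of "wadd (wadd (gen 0) (gen 1)) (gen 2)" "wadd (gen 0) (wadd (gen 1) (gen 2))" x y z,
      unfolded spec_simps]
  by (simp add: ghost_simps add.assoc)

lemma wadd_zero: "wadd wzero x = x"
  using witt_identity[of "wadd wzero (gen 0)" "gen 0" x x x, unfolded spec_simps]
  by (simp add: ghost_simps)

lemma wadd_neg: "wadd (wneg x wzero) x = wzero"
  using witt_identity[of "wadd (wneg (gen 0) wzero) (gen 0)" wzero x x x, unfolded spec_simps]
  by (simp add: ghost_simps)

lemma wmul_commute: "wmul x y = wmul y x"
  using witt_identity[of "wmul (gen 0) (gen 1)" "wmul (gen 1) (gen 0)" x y x, unfolded spec_simps]
  by (simp add: ghost_simps)

lemma wmul_assoc: "wmul (wmul x y) z = wmul x (wmul y z)"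
  using witt_identity[of "wmul (wmul (gen 0) (gen 1)) (gen 2)" "wmul (gen 0) (wmul (gen 1) (gen 2))" x y z,
      unfolded spec_simps]
  by (simp add: ghost_simps mult.assoc)

lemma wmul_one: "wmul wone x = x"
  using witt_identity[of "wmul wone (gen 0)" "gen 0" x x x, unfolded spec_simps]
  by (simp add: ghost_simps)

lemma wmul_distrib: "wmul (wadd x y) z = wadd (wmul x z) (wmul y z)"
  using witt_identity[of "wmul (wadd (gen 0) (gen 1)) (gen 2)"
      "wadd (wmul (gen 0) (gen 2)) (wmul (gen 1) (gen 2))" x y z, unfolded spec_simps]
  by (simp add: ghost_simps distrib_right)

end


section \<open>Witt vectors\<close>

text \<open>The \<open>p\<close>-typical Witt vectors over a ring of prime characteristic \<open>p\<close>; the prime is read off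
  from the type of the coefficients. If \<open>K\<close> is a field of characteristic \<open>p\<close>, every nonzero \<open>K\<close>-algebra
  has characteristic \<open>p\<close> (lemma \<open>CHAR_algebra\<close>). The zero ring carries no pseudovaluation,
  as \<open>\<nu>(0) = \<infinity>\<close> and \<open>\<nu>(1) = 0\<close>, so excluding it here loses nothing.\<close>

datatype 'a witt = Witt (wcoeff: "nat \<Rightarrow> 'a")

instantiation witt :: (comm_ring_prime_char) comm_ring_1
begin

definition zero_witt :: "'a witt" where
  "0 = Witt (\<lambda>_. 0)"

definition one_witt :: "'a witt" where
  "1 = Witt (\<lambda>i. if i = 0 then 1 else 0)"

definition plus_witt :: "'a witt \<Rightarrow> 'a witt \<Rightarrow> 'a witt" where
  "x + y = Witt (weval (witt_op CHAR('a) (+)) (wcoeff x) (wcoeff y))"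

definition times_witt :: "'a witt \<Rightarrow> 'a witt \<Rightarrow> 'a witt" where
  "x * y = Witt (weval (witt_op CHAR('a) (*)) (wcoeff x) (wcoeff y))"

definition uminus_witt :: "'a witt \<Rightarrow> 'a witt" where
  "- x = Witt (weval (witt_op CHAR('a) (\<lambda>X Y. - X)) (wcoeff x) (\<lambda>_. 0))"

definition minus_witt :: "'a witt \<Rightarrow> 'a witt \<Rightarrow> 'a witt" where
  "x - y = x + - (y :: 'a witt)"

instance
proof
  fix x y z :: "'a witt"
  note p = CHAR_prime[where 'a = 'a]
  show "x + y + z = x + (y + z)" by (simp add: plus_witt_def wadd_assoc[OF p])
  show "x + y = y + x" by (simp add: plus_witt_def wadd_commute[OF p])
  show "0 + x = x" by (simp add: plus_witt_def zero_witt_def wadd_zero[OF p])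
  show "- x + x = 0" by (simp add: plus_witt_def zero_witt_def uminus_witt_def wadd_neg[OF p])
  show "x - y = x + - y" by (rule minus_witt_def)
  show "x * y * z = x * (y * z)" by (simp add: times_witt_def wmul_assoc[OF p])
  show "x * y = y * x" by (simp add: times_witt_def wmul_commute[OF p])
  show "1 * x = x" by (simp add: times_witt_def one_witt_def wmul_one[OF p])
  show "(x + y) * z = x * z + y * z" by (simp add: times_witt_def plus_witt_def wmul_distrib[OF p])
  show "(0 :: 'a witt) \<noteq> 1" by (auto simp: zero_witt_def one_witt_def fun_eq_iff)
qed

end

definition w0 :: "'a witt \<Rightarrow> 'a" where
  "w0 \<alpha> = wcoeff \<alpha> 0"

lemma is_ring_hom_w0: "is_ring_hom (w0 :: 'a::comm_ring_prime_char witt \<Rightarrow> 'a)"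
proof -
  note p = CHAR_prime[where 'a = 'a]
  have g0: "ghost CHAR('a) 0 x = x 0" for x :: "nat \<Rightarrow> 'a"
    by (simp add: ghost_def)
  have "wadd CHAR('a) x y 0 = x 0 + y 0" for x y :: "nat \<Rightarrow> 'a"
    using ghost_add[OF p, of 0 x y] by (simp only: g0)
  moreover have "wmul CHAR('a) x y 0 = x 0 * y 0" for x y :: "nat \<Rightarrow> 'a"
    using ghost_mult[OF p, of 0 x y] by (simp only: g0)
  ultimately show ?thesis
    by (simp add: is_ring_hom_def w0_def one_witt_def plus_witt_def times_witt_def)
qed


section \<open>Overconvergent Witt vectors\<close>

definition witt_gauss :: "('a::comm_ring_prime_char \<Rightarrow> ereal) \<Rightarrow> real \<Rightarrow> 'a witt \<Rightarrow> ereal" where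
  "witt_gauss \<nu> \<epsilon> \<alpha> = (INF i. ereal (real i) + ereal (\<epsilon> / real (CHAR('a) ^ i)) * \<nu> (wcoeff \<alpha> i))"

definition overconvergent_radius :: "('a::comm_ring_prime_char \<Rightarrow> ereal) \<Rightarrow> real \<Rightarrow> 'a witt set" where
  "overconvergent_radius \<nu> \<epsilon> = {\<alpha>. witt_gauss \<nu> \<epsilon> \<alpha> \<noteq> - \<infinity>}"

definition overconvergent_witt :: "('a::comm_ring_prime_char \<Rightarrow> ereal) \<Rightarrow> 'a witt set" where
  "overconvergent_witt \<nu> = (\<Union>\<epsilon>\<in>{0<..}. overconvergent_radius \<nu> \<epsilon>)"

end

theory Submission
  imports Defs
begin

text \<open>The unit \<open>f'(a)\<close> turns the equation into a fixed point problem. Write \<open>c = [a]\<close> and \<open>u = [b]\<close> for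
the Teichmueller representatives of \<open>a\<close> and of the inverse \<open>b\<close> of \<open>f'(a)\<close>. Since \<open>u\<close> is cancellable
in \<open>W(A)\<close> (lemma \<open>unit_cancel\<close>), \<open>f(c + x) = 0\<close> holds if and only if \<open>x\<close> is a fixed point of
\<open>h(T) = T - u f(c + T)\<close>, and the choice of \<open>u\<close> puts both the constant and the linear coefficient of \<open>h\<close>
into \<open>VW(A)\<close>. Two Witt vectors in \<open>VW(A)\<close> that agree in the components below \<open>n\<close> have therefore images
under \<open>h\<close> that agree below \<open>n + 1\<close> (\<open>vadic_contraction\<close>). This gives uniqueness at once, and the iterates
\<open>0, h(0), h(h(0)), \<dots>\<close> stabilise in each component, to a fixed point.

It remains to see that the fixed point is overconvergent. The set of \<open>\<alpha>\<close> with \<open>\<gamma>\<^sub>\<epsilon>(\<alpha>) \<ge> r\<close> is described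
by one condition on each component, so it contains the limit as soon as it contains all iterates.
The iterates stay in \<open>\<gamma>\<^sub>\<epsilon> \<ge> 1/2\<close> if the
\<open>k\<close>-th coefficient of \<open>h\<close> satisfies \<open>\<gamma>\<^sub>\<epsilon> \<ge> 1/2 - k/2\<close>. For small \<open>\<epsilon>\<close> this is so: for an overconvergent
\<open>\<alpha>\<close>, as \<open>\<epsilon>\<close> tends to \<open>0\<close>, \<open>\<gamma>\<^sub>\<epsilon>(\<alpha>)\<close> eventually exceeds any given number below \<open>0\<close>, and any given number
below \<open>1\<close> if \<open>\<alpha>\<close> lies in \<open>VW(A)\<close> (\<open>eventually_gauss_ball\<close>).

All this rests on the two inequalities \<open>\<gamma>\<^sub>\<epsilon>(\<alpha> + \<beta>) \<ge> min (\<gamma>\<^sub>\<epsilon>(\<alpha>)) (\<gamma>\<^sub>\<epsilon>(\<beta>))\<close> and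
\<open>\<gamma>\<^sub>\<epsilon>(\<alpha>\<beta>) \<ge> \<gamma>\<^sub>\<epsilon>(\<alpha>) + \<gamma>\<^sub>\<epsilon>(\<beta>)\<close>. The first follows from the weights of the universal polynomials: if the
\<open>i\<close>-th variables have weight \<open>p\<^sup>i\<close>, the \<open>n\<close>-th sum polynomial is isobaric of weight \<open>p\<^sup>n\<close>. The second
uses characteristic \<open>p\<close>: by additivity it reduces to
\<open>V\<^sup>i[a] V\<^sup>j[b] = V\<^sup>i\<^sup>+\<^sup>j[a\<^bsup>p^j\<^esup> b\<^bsup>p^i\<^esup>]\<close> (\<open>vteich_mult\<close>). For the trivial pseudovaluation \<open>\<gamma>\<^sub>1\<close> is
the index of the first nonzero component, so the V-adic filtration is a special case of
the Gauss norms, and every statement about polynomials over a filtered ring serves both purposes.\<close>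

section \<open>Isobaric polynomials and the growth of Witt components\<close>

definition multi_weight :: "('x \<Rightarrow> nat) \<Rightarrow> ('x \<Rightarrow>\<^sub>0 nat) \<Rightarrow> nat" where
  "multi_weight wt k = (\<Sum>i\<in>Poly_Mapping.keys k. Poly_Mapping.lookup k i * wt i)"

lemma multi_weight_superset:
  assumes "finite S" "Poly_Mapping.keys k \<subseteq> S"
  shows "multi_weight wt k = (\<Sum>i\<in>S. Poly_Mapping.lookup k i * wt i)"
  unfolding multi_weight_def
  by (rule sum.mono_neutral_left) (use assms in \<open>auto simp: in_keys_iff\<close>)

lemma multi_weight_add: "multi_weight wt (k + l) = multi_weight wt k + multi_weight wt l"
proof -
  let ?S = "Poly_Mapping.keys k \<union> Poly_Mapping.keys l"
  have "multi_weight wt (k + l) = (\<Sum>i\<in>?S. Poly_Mapping.lookup (k + l) i * wt i)"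
    by (rule multi_weight_superset) (simp_all add: Poly_Mapping.keys_add)
  then show ?thesis
    using multi_weight_superset[of ?S k wt] multi_weight_superset[of ?S l wt]
    by (simp add: lookup_add distrib_right sum.distrib)
qed

definition isobaric :: "('x \<Rightarrow> nat) \<Rightarrow> nat \<Rightarrow> ('x, int) mpoly \<Rightarrow> bool" where
  "isobaric wt d P \<longleftrightarrow> (\<forall>k\<in>Poly_Mapping.keys P. multi_weight wt k = d)"

lemma isobaric_0: "isobaric wt d 0"
  by (simp add: isobaric_def)

lemma isobaric_1: "isobaric wt 0 1"
  by (simp add: isobaric_def multi_weight_def)

lemma isobaric_mvar: "isobaric wt (wt i) (mvar i)"
  by (simp add: isobaric_def mvar_def multi_weight_def)

lemma isobaric_add: "isobaric wt d P \<Longrightarrow> isobaric wt d Q \<Longrightarrow> isobaric wt d (P + Q)"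
  unfolding isobaric_def using Poly_Mapping.keys_add[of P Q] by blast

lemma isobaric_uminus: "isobaric wt d P \<Longrightarrow> isobaric wt d (- P)"
  by (simp add: isobaric_def)

lemma isobaric_diff: "isobaric wt d P \<Longrightarrow> isobaric wt d Q \<Longrightarrow> isobaric wt d (P - Q)"
  using isobaric_add[of wt d P "- Q"] isobaric_uminus[of wt d Q] by simp

lemma isobaric_sum: "(\<And>i. i \<in> S \<Longrightarrow> isobaric wt d (F i)) \<Longrightarrow> isobaric wt d (sum F S)"
  by (induction S rule: infinite_finite_induct) (auto intro: isobaric_add isobaric_0)

lemma isobaric_mult:
  assumes "isobaric wt d P" "isobaric wt e Q"
  shows "isobaric wt (d + e) (P * Q)"
  unfolding isobaric_def
proof
  fix k assume "k \<in> Poly_Mapping.keys (P * Q)"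
  then obtain a b where "a \<in> Poly_Mapping.keys P" "b \<in> Poly_Mapping.keys Q" "k = a + b"
    using Poly_Mapping.keys_mult[of P Q] by blast
  then show "multi_weight wt k = d + e"
    using assms by (simp add: isobaric_def multi_weight_add)
qed

lemma isobaric_power: "isobaric wt d P \<Longrightarrow> isobaric wt (n * d) (P ^ n)"
  by (induction n) (auto intro: isobaric_1 isobaric_mult)

lemma of_nat_mult_eq_frag_cmul: "of_nat n * (R :: ('x, int) mpoly) = frag_cmul (int n) R"
  by (induction n) (simp_all add: distrib_right frag_cmul_distrib)

lemma isobaric_of_nat_mult_iff:
  "n > 0 \<Longrightarrow> isobaric wt d (of_nat n * P) \<longleftrightarrow> isobaric wt d P"
  by (auto simp: isobaric_def of_nat_mult_eq_frag_cmul)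

lemma isobaric_ghost_term:
  assumes "p > 0" "i \<le> n" "isobaric wt (d * p ^ i) P"
  shows "isobaric wt (d * p ^ n) (of_nat p ^ i * P ^ (p ^ (n - i)))"
proof -
  have "p ^ (n - i) * (d * p ^ i) = d * p ^ n"
    using assms(2) by (simp add: power_add[symmetric])
  with isobaric_power[OF assms(3), of "p ^ (n - i)"] assms(1) show ?thesis
    by (simp add: isobaric_of_nat_mult_iff flip: of_nat_power)
qed

lemma isobaric_ghost:
  assumes "p > 0" "\<And>i. i \<le> n \<Longrightarrow> isobaric wt (d * p ^ i) (x i)"
  shows "isobaric wt (d * p ^ n) (ghost p n x)"
  unfolding ghost_def using assms by (intro isobaric_sum isobaric_ghost_term) auto

text \<open>The ghost equations determine the components recursively, up to the integer factor \<open>p\<^sup>n\<close>, and that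
factor does not change which monomials occur; so the weights of the ghost components pass to the components.\<close>

lemma isobaric_if_isobaric_ghost:
  assumes p: "p > 0" and g: "\<And>n. isobaric wt (p ^ n) (ghost p n s)"
  shows "isobaric wt (p ^ n) (s n)"
proof (induction n rule: less_induct)
  case (less n)
  have "of_nat p ^ n * s n = ghost p n s - (\<Sum>i<n. of_nat p ^ i * s i ^ (p ^ (n - i)))"
    by (simp add: ghost_def lessThan_Suc_atMost[symmetric])
  moreover have "isobaric wt (p ^ n) (\<Sum>i<n. of_nat p ^ i * s i ^ (p ^ (n - i)))"
    using isobaric_ghost_term[OF p, of _ n wt 1] less by (intro isobaric_sum) simp
  ultimately have "isobaric wt (p ^ n) (of_nat p ^ n * s n)"
    by (simp only: isobaric_diff[OF g])
  with p show ?case by (simp add: isobaric_of_nat_mult_iff flip: of_nat_power)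
qed

context
  fixes p :: nat
  assumes p: "prime p"
begin

lemma isobaric_witt_add: "isobaric (case_sum (\<lambda>i. p ^ i) (\<lambda>i. p ^ i)) (p ^ n) (witt_op p (+) n)"
proof (rule isobaric_if_isobaric_ghost[OF prime_gt_0_nat[OF p]])
  fix n
  let ?wt = "case_sum (\<lambda>i. p ^ i) (\<lambda>i. p ^ i) :: nat + nat \<Rightarrow> nat"
  have X: "isobaric ?wt (p ^ n) (ghost p n (\<lambda>i. mvar (Inl i)))"
    and Y: "isobaric ?wt (p ^ n) (ghost p n (\<lambda>i. mvar (Inr i)))" for n
    using isobaric_ghost[OF prime_gt_0_nat[OF p], of n ?wt 1 "\<lambda>i. mvar (Inl i)"] isobaric_mvar[of ?wt "Inl _"]
      isobaric_ghost[OF prime_gt_0_nat[OF p], of n ?wt 1 "\<lambda>i. mvar (Inr i)"] isobaric_mvar[of ?wt "Inr _"]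
    by simp_all
  show "isobaric ?wt (p ^ n) (ghost p n (witt_op p (+)))"
    using X Y by (subst ghost_witt_op[OF p]) (auto intro: dwork_add dwork_ghost_mvar isobaric_add)
qed

lemma isobaric_witt_uminus: "isobaric (case_sum (\<lambda>i. p ^ i) (\<lambda>_. 0)) (p ^ n) (witt_op p (\<lambda>X Y. - X) n)"
proof (rule isobaric_if_isobaric_ghost[OF prime_gt_0_nat[OF p]])
  fix n
  let ?wt = "case_sum (\<lambda>i. p ^ i) (\<lambda>_. 0) :: nat + nat \<Rightarrow> nat"
  have X: "isobaric ?wt (p ^ n) (ghost p n (\<lambda>i. mvar (Inl i)))"
    using isobaric_ghost[OF prime_gt_0_nat[OF p], of n ?wt 1 "\<lambda>i. mvar (Inl i)"] isobaric_mvar[of ?wt "Inl _"]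
    by simp
  then show "isobaric ?wt (p ^ n) (ghost p n (witt_op p (\<lambda>X Y. - X)))"
    by (subst ghost_witt_op[OF p]) (auto intro: dwork_uminus dwork_ghost_mvar isobaric_uminus)
qed

text \<open>Here only the first family of variables carries weight. Every monomial of a product polynomial thus contains a
variable of that family, which will show that the Witt vectors with vanishing components below \<open>N\<close>
form an ideal.\<close>

lemma isobaric_witt_mult: "isobaric (case_sum (\<lambda>i. p ^ i) (\<lambda>_. 0)) (p ^ n) (witt_op p (*) n)"
proof (rule isobaric_if_isobaric_ghost[OF prime_gt_0_nat[OF p]])
  fix n
  let ?wt = "case_sum (\<lambda>i. p ^ i) (\<lambda>_. 0) :: nat + nat \<Rightarrow> nat"
  have X: "isobaric ?wt (p ^ n) (ghost p n (\<lambda>i. mvar (Inl i)))"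
    and Y: "isobaric ?wt 0 (ghost p n (\<lambda>i. mvar (Inr i)))"
    using isobaric_ghost[OF prime_gt_0_nat[OF p], of n ?wt 1 "\<lambda>i. mvar (Inl i)"] isobaric_mvar[of ?wt "Inl _"]
      isobaric_ghost[OF prime_gt_0_nat[OF p], of n ?wt 0 "\<lambda>i. mvar (Inr i)"] isobaric_mvar[of ?wt "Inr _"]
    by simp_all
  show "isobaric ?wt (p ^ n) (ghost p n (witt_op p (*)))"
    using isobaric_mult[OF X Y]
    by (subst ghost_witt_op[OF p]) (auto intro: dwork_mult dwork_ghost_mvar)
qed

end

context
  fixes \<nu> :: "'a::comm_ring_1 \<Rightarrow> ereal"
  assumes \<nu>: "proper_pseudovaluation \<nu>"
begin

lemma val_0: "\<nu> 0 = \<infinity>"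
  and val_1: "\<nu> 1 = 0"
  and val_not_minf: "\<nu> a \<noteq> - \<infinity>"
  using \<nu> by (auto simp: proper_pseudovaluation_def pseudovaluation_def)

lemma val_add_ge: "r \<le> \<nu> a \<Longrightarrow> r \<le> \<nu> b \<Longrightarrow> r \<le> \<nu> (a + b)"
  and val_diff_ge: "r \<le> \<nu> a \<Longrightarrow> r \<le> \<nu> b \<Longrightarrow> r \<le> \<nu> (a - b)"
  using \<nu> unfolding proper_pseudovaluation_def pseudovaluation_def
  by (meson min.boundedI order_trans)+

lemma val_mult_ge: "r \<le> \<nu> a \<Longrightarrow> s \<le> \<nu> b \<Longrightarrow> r + s \<le> \<nu> (a * b)"
  using \<nu> unfolding proper_pseudovaluation_def pseudovaluation_def
  by (meson add_mono order_trans)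

lemma val_sum_ge: "(\<And>i. i \<in> S \<Longrightarrow> r \<le> \<nu> (f i)) \<Longrightarrow> r \<le> \<nu> (sum f S)"
  by (induction S rule: infinite_finite_induct) (auto simp: val_0 intro: val_add_ge)

lemma val_prod_ge:
  "(\<And>i. i \<in> S \<Longrightarrow> ereal (r i) \<le> \<nu> (f i)) \<Longrightarrow> ereal (sum r S) \<le> \<nu> (prod f S)"
proof (induction S rule: infinite_finite_induct)
  case (insert i S)
  then show ?case using val_mult_ge[of "ereal (r i)" "f i" "ereal (sum r S)"] by simp
qed (simp_all add: val_1)

lemma val_power_ge: "ereal r \<le> \<nu> a \<Longrightarrow> ereal (real n * r) \<le> \<nu> (a ^ n)"
  using val_prod_ge[of "{..<n}" "\<lambda>_. r" "\<lambda>_. a"] by simp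

lemma val_of_int_ge: "0 \<le> \<nu> (of_int n)"
proof -
  have nat: "0 \<le> \<nu> (of_nat n)" for n
    by (induction n) (auto simp: val_0 val_1 intro: val_add_ge)
  show ?thesis
  proof (cases n)
    case (neg m)
    then show ?thesis using val_diff_ge[of 0 0 "of_nat (Suc m)"] nat[of "Suc m"]
      by (simp add: val_0 del: of_nat_Suc)
  qed (use nat in simp)
qed

text \<open>A lower bound for the values of the variables that is proportional to their weights carries over to
isobaric polynomials. Only weights up to \<open>d\<close> are at stake, because a variable of larger weight
cannot occur; in this way the \<open>n\<close>-th Witt polynomials do not see the components beyond \<open>n\<close>.\<close>

lemma val_meval_isobaric_ge:
  assumes P: "isobaric wt d P"
    and x: "\<And>i. wt i \<le> d \<Longrightarrow> ereal (real (wt i) * \<rho>) \<le> \<nu> (x i)"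
  shows "ereal (real d * \<rho>) \<le> \<nu> (meval x P)"
  unfolding meval_def
proof (rule val_sum_ge)
  fix k assume "k \<in> Poly_Mapping.keys P"
  then have k: "multi_weight wt k = d" using P by (simp add: isobaric_def)
  have "ereal (\<Sum>i\<in>Poly_Mapping.keys k. real (Poly_Mapping.lookup k i) * (real (wt i) * \<rho>)) \<le> \<nu> (mmon x k)"
    unfolding mmon_def
  proof (intro val_prod_ge val_power_ge x)
    fix i assume i: "i \<in> Poly_Mapping.keys k"
    then have "Poly_Mapping.lookup k i \<noteq> 0" by (simp add: in_keys_iff)
    then have "wt i \<le> Poly_Mapping.lookup k i * wt i" by simp
    also have "\<dots> \<le> multi_weight wt k"
      unfolding multi_weight_def using i by (intro member_le_sum) auto
    finally show "wt i \<le> d" by (simp add: k)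
  qed
  also have "(\<Sum>i\<in>Poly_Mapping.keys k. real (Poly_Mapping.lookup k i) * (real (wt i) * \<rho>)) = real d * \<rho>"
    by (simp add: k[symmetric] multi_weight_def sum_distrib_right mult.assoc)
  finally show "ereal (real d * \<rho>) \<le> \<nu> (of_int (Poly_Mapping.lookup P k) * mmon x k)"
    using val_mult_ge[OF val_of_int_ge] by fastforce
qed

end

text \<open>The Gauss norm of this pseudovaluation (with \<open>\<epsilon> = 1\<close>) is the order of vanishing of a Witt vector, which makes
it possible to treat V-adic estimates as Gauss norm estimates.\<close>

definition trivial_val :: "'a::comm_ring_1 \<Rightarrow> ereal" where
  "trivial_val a = (if a = 0 then \<infinity> else 0)"

lemma proper_trivial: "proper_pseudovaluation trivial_val"
  by (auto simp: proper_pseudovaluation_def pseudovaluation_def trivial_val_def)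

section \<open>Verschiebungs of Teichmueller representatives\<close>

text \<open>This is how identities special to characteristic \<open>p\<close> are proved on ghost components: congruence of the \<open>n\<close>-th ghosts modulo
\<open>p\<^sup>n\<^sup>+\<^sup>1\<close> determines the components modulo \<open>p\<close>, which is all that a ring of characteristic \<open>p\<close> can see. The induction works because \<open>u \<equiv> v\<close> modulo \<open>p\<close> implies
\<open>u\<^bsup>p^k\<^esup> \<equiv> v\<^bsup>p^k\<^esup>\<close> modulo \<open>p\<^sup>k\<^sup>+\<^sup>1\<close>.\<close>

lemma ghost_cong_imp_dvd:
  fixes u v :: "nat \<Rightarrow> ('x, int) mpoly"
  assumes p: "p > 0" and cong: "\<And>n. of_nat p ^ Suc n dvd ghost p n u - ghost p n v"
  shows "of_nat p dvd u n - v n"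
proof (induction n rule: less_induct)
  case (less n)
  let ?t = "\<lambda>w i. of_nat p ^ i * w i ^ (p ^ (n - i)) :: ('x, int) mpoly"
  have "of_nat p ^ Suc n dvd (\<Sum>i<n. ?t u i - ?t v i)"
  proof (rule dvd_sum)
    fix i assume "i \<in> {..<n}"
    then have i: "i < n" by simp
    then have "of_nat p ^ Suc n = (of_nat p ^ i * of_nat p ^ Suc (n - i) :: ('x, int) mpoly)"
      by (simp add: power_add[symmetric] del: power_Suc)
    then show "of_nat p ^ Suc n dvd ?t u i - ?t v i"
      using dvd_power_iter[OF less[OF i], of "n - i"]
      by (simp only: right_diff_distrib[symmetric] mult_dvd_mono dvd_refl)
  qed
  moreover have "of_nat p ^ n * (u n - v n) = (ghost p n u - ghost p n v) - (\<Sum>i<n. ?t u i - ?t v i)"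
    by (simp add: ghost_def lessThan_Suc_atMost[symmetric] sum_subtractf algebra_simps)
  ultimately have "of_nat p ^ Suc n dvd of_nat p ^ n * (u n - v n)"
    using cong[of n] by (simp only: dvd_diff)
  then obtain R where "of_nat p ^ n * (u n - v n) = of_nat p ^ Suc n * R" ..
  then have "of_nat (p ^ n) * (u n - v n) = of_nat (p ^ n) * (of_nat p * R)"
    by (simp add: mult_ac)
  then have "u n - v n = of_nat p * R"
    by (rule mpoly_cancel) (use p in simp)
  then show ?case by simp
qed

text \<open>The \<open>i\<close>-fold Verschiebung \<open>V\<^sup>i[a]\<close> of the Teichmueller representative of \<open>a\<close>.\<close>

definition vteich :: "nat \<Rightarrow> 'a \<Rightarrow> 'a::comm_ring_prime_char witt" where
  "vteich i a = Witt (\<lambda>n. if n = i then a else 0)"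

lemma ghost_delta:
  assumes "p > 0"
  shows "ghost p n (\<lambda>m. if m = i then a else 0) = (if i \<le> n then of_nat p ^ i * a ^ (p ^ (n - i)) else 0)"
proof -
  have "ghost p n (\<lambda>m. if m = i then a else 0) = (\<Sum>m\<le>n. if m = i then of_nat p ^ i * a ^ (p ^ (n - i)) else 0)"
    unfolding ghost_def by (rule sum.cong) (use assms in \<open>auto simp: zero_power\<close>)
  then show ?thesis by simp
qed

text \<open>For generic \<open>a\<close> and \<open>b\<close>, the \<open>n\<close>-th ghost components of both sides are equal if \<open>n \<ge> i + j\<close>. For smaller \<open>n\<close> the
right side has ghost \<open>0\<close> while the left side has ghost \<open>0\<close> or a multiple of \<open>p\<^sup>i\<^sup>+\<^sup>j\<close>; so the identity holds modulo \<open>p\<close>,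
although it fails over the integers as soon as \<open>i\<close> and \<open>j\<close> are positive.\<close>

lemma vteich_mult:
  fixes a b :: "'a::comm_ring_prime_char"
  shows "vteich i a * vteich j b = vteich (i + j) (a ^ (CHAR('a) ^ j) * b ^ (CHAR('a) ^ i))"
proof -
  define p where "p = CHAR('a)"
  have p: "prime p" by (simp add: p_def)
  have p0: "p > 0" by (rule prime_gt_0_nat[OF p])
  let ?\<delta> = "\<lambda>k (c :: (nat \<times> nat, int) mpoly) n. if n = k then c else (0 :: (nat \<times> nat, int) mpoly)"
  let ?x = "gen 0 0" and ?y = "gen 1 0"
  let ?u = "weval (witt_op p (*)) (?\<delta> i ?x) (?\<delta> j ?y)"
  let ?v = "?\<delta> (i + j) (?x ^ (p ^ j) * ?y ^ (p ^ i))"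
  let ?h = "spec (\<lambda>_. a) (\<lambda>_. b) (\<lambda>_. a)"
  note h = is_ring_hom_spec[of "\<lambda>_. a" "\<lambda>_. b" "\<lambda>_. a"]
  have "of_nat p ^ Suc n dvd ghost p n ?u - ghost p n ?v" for n
  proof (cases "i + j \<le> n")
    case True
    then have e: "p ^ j * p ^ (n - (i + j)) = p ^ (n - i)" "p ^ i * p ^ (n - (i + j)) = p ^ (n - j)"
      by (simp_all add: power_add[symmetric])
    have "(?x ^ p ^ j * ?y ^ p ^ i) ^ p ^ (n - (i + j)) = ?x ^ p ^ (n - i) * ?y ^ p ^ (n - j)"
      by (simp only: power_mult_distrib power_mult[symmetric] e)
    with True show ?thesis
      by (simp only: ghost_mult[OF p] ghost_delta[OF p0]) (simp add: power_add algebra_simps)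
  next
    case False
    then have "(of_nat p ^ Suc n :: (nat \<times> nat, int) mpoly) dvd of_nat p ^ (i + j)"
      by (intro le_imp_power_dvd) simp
    moreover have "ghost p n ?v = 0"
      using False by (simp only: ghost_delta[OF p0] if_False)
    moreover have "ghost p n ?u =
        (if i \<le> n \<and> j \<le> n then of_nat p ^ (i + j) * (?x ^ p ^ (n - i) * ?y ^ p ^ (n - j)) else 0)"
      by (simp only: ghost_mult[OF p] ghost_delta[OF p0]) (simp add: power_add mult_ac)
    ultimately show ?thesis
      by (simp del: power_Suc)
  qed
  then have "of_nat p dvd ?u n - ?v n" for n
    by (rule ghost_cong_imp_dvd[OF p0])
  then have "?h (?u n) = ?h (?v n)" for n
  proof -
    from \<open>of_nat p dvd ?u n - ?v n\<close> obtain R where "?u n - ?v n = of_nat p * R" ..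
    then have "?h (?u n) - ?h (?v n) = of_nat p * ?h R"
      by (metis hom_diff[OF h] hom_mult[OF h] hom_of_nat[OF h])
    then show ?thesis by (simp add: p_def)
  qed
  moreover have "?h ?x = a" "?h ?y = b" by (simp_all add: spec_def gen_def)
  ultimately show ?thesis
    by (simp add: times_witt_def vteich_def fun_eq_iff hom_weval[OF h] if_distrib[of ?h] hom_0[OF h]
        hom_mult[OF h] hom_power[OF h] p_def[symmetric] cong: if_cong)
qed

definition witt_restrict :: "nat set \<Rightarrow> 'a witt \<Rightarrow> 'a::comm_ring_prime_char witt" where
  "witt_restrict S \<alpha> = Witt (\<lambda>i. if i \<in> S then wcoeff \<alpha> i else 0)"

lemma wcoeff_restrict: "wcoeff (witt_restrict S \<alpha>) i = (if i \<in> S then wcoeff \<alpha> i else 0)"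
  by (simp add: witt_restrict_def)

lemma wcoeff_vteich: "wcoeff (vteich j a) i = (if i = j then a else 0)"
  by (simp add: vteich_def)

lemma wcoeff_0: "wcoeff 0 i = (0 :: 'a::comm_ring_prime_char)"
  by (simp add: zero_witt_def)

lemma witt_eqI: "(\<And>i. wcoeff \<alpha> i = wcoeff \<beta> i) \<Longrightarrow> \<alpha> = \<beta>"
  by (cases \<alpha>; cases \<beta>) (auto simp: fun_eq_iff)

text \<open>In each summand of the ghost components at most one of the two vectors contributes, so that the ghosts, and
with them the components, simply add.\<close>

lemma witt_restrict_disjoint_add:
  fixes \<alpha> :: "'a::comm_ring_prime_char witt"
  assumes "S \<inter> T = {}"
  shows "witt_restrict S \<alpha> + witt_restrict T \<alpha> = witt_restrict (S \<union> T) \<alpha>"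
proof -
  define p where "p = CHAR('a)"
  have p: "prime p" by (simp add: p_def)
  have p0: "p > 0" by (rule prime_gt_0_nat[OF p])
  let ?r = "\<lambda>S n. if n \<in> S then gen 0 n else (0 :: (nat \<times> nat, int) mpoly)"
  let ?x = "wcoeff \<alpha>"
  note h = is_ring_hom_spec[of ?x ?x ?x]
  have "ghost p n (weval (witt_op p (+)) (?r S) (?r T)) = ghost p n (?r (S \<union> T))" for n
    unfolding ghost_add[OF p] unfolding ghost_def sum.distrib[symmetric]
    by (rule sum.cong) (use assms p0 in \<open>auto simp: zero_power\<close>)
  from witt_identity[OF p this, of ?x ?x ?x]
  have "weval (witt_op p (+)) (\<lambda>i. spec ?x ?x ?x (?r S i)) (\<lambda>i. spec ?x ?x ?x (?r T i))
      = (\<lambda>i. spec ?x ?x ?x (?r (S \<union> T) i))"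
    by (simp only: hom_weval'[OF h])
  moreover have "spec ?x ?x ?x (?r S i) = (if i \<in> S then ?x i else 0)" for S i
    by (simp add: hom_0[OF h]) (simp add: spec_def gen_def)
  ultimately show ?thesis
    by (simp only: plus_witt_def witt_restrict_def p_def[symmetric] witt.sel)
qed

lemma witt_split: "\<alpha> = witt_restrict {..<N} \<alpha> + witt_restrict {N..} (\<alpha> :: 'a::comm_ring_prime_char witt)"
proof -
  have "{..<N} \<inter> {N..} = {}" "{..<N} \<union> {N..} = UNIV" by auto
  then show ?thesis
    by (simp add: witt_restrict_disjoint_add) (simp add: witt_restrict_def)
qed

lemma witt_restrict_eq_sum:
  "witt_restrict {..<N} \<alpha> = (\<Sum>i<N. vteich i (wcoeff \<alpha> i :: 'a::comm_ring_prime_char))"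
proof (induction N)
  case 0
  then show ?case by (simp add: witt_restrict_def zero_witt_def)
next
  case (Suc N)
  have "{..<N} \<inter> {N} = {}" "{..<N} \<union> {N} = {..<Suc N}" by auto
  then have "witt_restrict {..<Suc N} \<alpha> = witt_restrict {..<N} \<alpha> + witt_restrict {N} \<alpha>"
    by (simp add: witt_restrict_disjoint_add)
  also have "witt_restrict {N} \<alpha> = vteich N (wcoeff \<alpha> N)"
    by (rule witt_eqI) (simp add: wcoeff_restrict wcoeff_vteich)
  finally show ?case using Suc by simp
qed

section \<open>The Gauss norms\<close>

definition gauss_ball :: "('a::comm_ring_prime_char \<Rightarrow> ereal) \<Rightarrow> real \<Rightarrow> real \<Rightarrow> 'a witt set" where
  "gauss_ball \<nu> \<epsilon> r = {\<alpha>. ereal r \<le> witt_gauss \<nu> \<epsilon> \<alpha>}"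

text \<open>The inequality \<open>\<gamma>\<^sub>\<epsilon> \<ge> r\<close>, solved for the values of the components and restricted to the components below \<open>N\<close>.
The restriction lets a Witt vector be replaced by the finite sum of its terms \<open>V\<^sup>i[a\<^sub>i]\<close> with \<open>i < N\<close>.\<close>

definition gauss_below :: "('a::comm_ring_prime_char \<Rightarrow> ereal) \<Rightarrow> real \<Rightarrow> real \<Rightarrow> nat \<Rightarrow> 'a witt set" where
  "gauss_below \<nu> \<epsilon> r N =
     {\<alpha>. \<forall>i<N. ereal (real (CHAR('a) ^ i) * ((r - real i) / \<epsilon>)) \<le> \<nu> (wcoeff \<alpha> i)}"

lemma gauss_term_ge_iff:
  assumes "\<epsilon> > 0" "q > 0" "v \<noteq> - \<infinity>"
  shows "ereal r \<le> ereal i + ereal (\<epsilon> / q) * v \<longleftrightarrow> ereal (q * ((r - i) / \<epsilon>)) \<le> v"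
  using assms by (cases v) (auto simp: field_simps)

locale witt_valuation =
  fixes \<nu> :: "'a::comm_ring_prime_char \<Rightarrow> ereal" and \<epsilon> :: real
  assumes proper: "proper_pseudovaluation \<nu>" and \<epsilon>: "\<epsilon> > 0"
begin

lemma mem_gauss_ball_iff:
  "\<alpha> \<in> gauss_ball \<nu> \<epsilon> r \<longleftrightarrow> (\<forall>i. ereal (real (CHAR('a) ^ i) * ((r - real i) / \<epsilon>)) \<le> \<nu> (wcoeff \<alpha> i))"
  unfolding gauss_ball_def witt_gauss_def le_INF_iff mem_Collect_eq
  using \<epsilon> prime_gt_0_nat[OF CHAR_prime[where 'a = 'a]]
  by (subst gauss_term_ge_iff) (auto simp: val_not_minf[OF proper])

lemma gauss_ball_eq: "gauss_ball \<nu> \<epsilon> r = (\<Inter>N. gauss_below \<nu> \<epsilon> r N)"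
  unfolding set_eq_iff mem_gauss_ball_iff by (auto simp: gauss_below_def intro: lessI)

text \<open>For \<open>i \<le> n\<close> the bound at index \<open>i\<close> implies one proportional to the weight \<open>p\<^sup>i\<close>, with the factor belonging to \<open>n\<close>.
Its last premise is stated in terms of weights to match \<open>val_meval_isobaric_ge\<close>.\<close>

lemma gauss_below_scale:
  assumes "\<alpha> \<in> gauss_below \<nu> \<epsilon> r N" "n < N" "CHAR('a) ^ i \<le> CHAR('a) ^ n"
  shows "ereal (real (CHAR('a) ^ i) * ((r - real n) / \<epsilon>)) \<le> \<nu> (wcoeff \<alpha> i)"
proof -
  have i: "i \<le> n"
    using assms(3) prime_gt_1_nat[OF CHAR_prime[where 'a = 'a]] by simp
  have "real (CHAR('a) ^ i) * ((r - real n) / \<epsilon>) \<le> real (CHAR('a) ^ i) * ((r - real i) / \<epsilon>)"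
    using i \<epsilon> by (intro mult_left_mono divide_right_mono) auto
  also have "ereal \<dots> \<le> \<nu> (wcoeff \<alpha> i)"
    using assms i by (simp add: gauss_below_def)
  finally show ?thesis by simp
qed

lemma gauss_below_0: "0 \<in> gauss_below \<nu> \<epsilon> r N"
  by (simp add: gauss_below_def wcoeff_0 val_0[OF proper])

lemma gauss_below_add:
  assumes "\<alpha> \<in> gauss_below \<nu> \<epsilon> r N" "\<beta> \<in> gauss_below \<nu> \<epsilon> r N"
  shows "\<alpha> + \<beta> \<in> gauss_below \<nu> \<epsilon> r N"
  unfolding gauss_below_def mem_Collect_eq plus_witt_def witt.sel weval_def
proof (intro allI impI val_meval_isobaric_ge[OF proper isobaric_witt_add[OF CHAR_prime]])
  fix n i assume "n < N" and "case_sum (\<lambda>i. CHAR('a) ^ i) (\<lambda>i. CHAR('a) ^ i) i \<le> CHAR('a) ^ n"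
  then show "ereal (real (case_sum (\<lambda>i. CHAR('a) ^ i) (\<lambda>i. CHAR('a) ^ i) i) * ((r - real n) / \<epsilon>))
      \<le> \<nu> (case_sum (wcoeff \<alpha>) (wcoeff \<beta>) i)"
    by (cases i) (use gauss_below_scale assms in simp_all)
qed

lemma gauss_below_uminus:
  assumes "\<alpha> \<in> gauss_below \<nu> \<epsilon> r N"
  shows "- \<alpha> \<in> gauss_below \<nu> \<epsilon> r N"
  unfolding gauss_below_def mem_Collect_eq uminus_witt_def witt.sel weval_def
proof (intro allI impI val_meval_isobaric_ge[OF proper isobaric_witt_uminus[OF CHAR_prime]])
  fix n i assume "n < N" and "case_sum (\<lambda>i. CHAR('a) ^ i) (\<lambda>_. 0) i \<le> CHAR('a) ^ n"
  then show "ereal (real (case_sum (\<lambda>i. CHAR('a) ^ i) (\<lambda>_. 0) i) * ((r - real n) / \<epsilon>))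
      \<le> \<nu> (case_sum (wcoeff \<alpha>) (\<lambda>_. 0) i)"
    by (cases i) (use gauss_below_scale assms in \<open>simp_all add: val_0[OF proper]\<close>)
qed

lemma gauss_below_sum:
  "(\<And>i. i \<in> S \<Longrightarrow> f i \<in> gauss_below \<nu> \<epsilon> r N) \<Longrightarrow> sum f S \<in> gauss_below \<nu> \<epsilon> r N"
  by (induction S rule: infinite_finite_induct) (auto intro: gauss_below_add gauss_below_0)

text \<open>Every monomial of the \<open>n\<close>-th product polynomial contains a variable of the first family of index at most \<open>n\<close>, so
the product vanishes below \<open>N\<close>. The weight estimate for the trivial pseudovaluation expresses this: a positive
bound forces the value \<open>\<infinity>\<close>.\<close>

lemma tail_mult_gauss_below: "witt_restrict {N..} \<alpha> * \<beta> \<in> gauss_below \<nu> \<epsilon> r N"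
  unfolding gauss_below_def mem_Collect_eq
proof (intro allI impI)
  fix n assume n: "n < N"
  have "ereal (real (CHAR('a) ^ n) * 1) \<le> trivial_val (wcoeff (witt_restrict {N..} \<alpha> * \<beta>) n)"
    unfolding times_witt_def witt.sel weval_def
  proof (rule val_meval_isobaric_ge[OF proper_trivial isobaric_witt_mult[OF CHAR_prime]])
    fix i :: "nat + nat" assume "case_sum (\<lambda>i. CHAR('a) ^ i) (\<lambda>_. 0) i \<le> CHAR('a) ^ n"
    then show "ereal (real (case_sum (\<lambda>i. CHAR('a) ^ i) (\<lambda>_. 0) i) * 1)
        \<le> trivial_val (case_sum (wcoeff (witt_restrict {N..} \<alpha>)) (wcoeff \<beta>) i)"
      using n prime_gt_1_nat[OF CHAR_prime[where 'a = 'a]]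
      by (cases i) (auto simp: wcoeff_restrict trivial_val_def)
  qed
  moreover have "0 < real CHAR('a) ^ n"
    using prime_gt_0_nat[OF CHAR_prime[where 'a = 'a]] by simp
  ultimately have "wcoeff (witt_restrict {N..} \<alpha> * \<beta>) n = 0"
    by (simp add: trivial_val_def linorder_not_less[symmetric] del: linorder_not_less split: if_splits)
  then show "ereal (real (CHAR('a) ^ n) * ((r - real n) / \<epsilon>)) \<le> \<nu> (wcoeff (witt_restrict {N..} \<alpha> * \<beta>) n)"
    by (simp add: val_0[OF proper])
qed

text \<open>The weights of the product polynomials are not enough here: over the integers, \<open>V[a] V[b] = p V[ab]\<close> has a nonzero
component at index \<open>1\<close>, where the bound for \<open>\<alpha>\<beta>\<close> may fail. In characteristic \<open>p\<close> the term moves to index \<open>2\<close>, and each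
product \<open>V\<^sup>i[a\<^sub>i] V\<^sup>j[b\<^sub>j]\<close> satisfies the bound on its own.\<close>

lemma gauss_below_mult:
  assumes \<alpha>: "\<alpha> \<in> gauss_below \<nu> \<epsilon> r N" and \<beta>: "\<beta> \<in> gauss_below \<nu> \<epsilon> s N"
  shows "\<alpha> * \<beta> \<in> gauss_below \<nu> \<epsilon> (r + s) N"
proof -
  let ?p = "CHAR('a)"
  let ?a = "\<lambda>i. vteich i (wcoeff \<alpha> i)" and ?b = "\<lambda>i. vteich i (wcoeff \<beta> i)"
  have "?a i * ?b j \<in> gauss_below \<nu> \<epsilon> (r + s) N" if "i < N" "j < N" for i j
  proof -
    have "ereal (real (?p ^ j) * (real (?p ^ i) * ((r - real i) / \<epsilon>))) \<le> \<nu> (wcoeff \<alpha> i ^ ?p ^ j)"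
      "ereal (real (?p ^ i) * (real (?p ^ j) * ((s - real j) / \<epsilon>))) \<le> \<nu> (wcoeff \<beta> j ^ ?p ^ i)"
      using \<alpha> \<beta> that by (intro val_power_ge[OF proper]; simp add: gauss_below_def)+
    note val_mult_ge[OF proper this]
    moreover have "real (?p ^ j) * (real (?p ^ i) * ((r - real i) / \<epsilon>))
        + real (?p ^ i) * (real (?p ^ j) * ((s - real j) / \<epsilon>))
      = real (?p ^ (i + j)) * ((r + s - real (i + j)) / \<epsilon>)"
      using \<epsilon> by (simp add: power_add field_simps)
    ultimately show ?thesis
      by (auto simp: vteich_mult gauss_below_def wcoeff_vteich val_0[OF proper])
  qed
  then have main: "witt_restrict {..<N} \<alpha> * witt_restrict {..<N} \<beta> \<in> gauss_below \<nu> \<epsilon> (r + s) N"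
    by (auto simp: witt_restrict_eq_sum sum_product intro!: gauss_below_sum)
  have "\<alpha> * \<beta> = witt_restrict {..<N} \<alpha> * \<beta> + witt_restrict {N..} \<alpha> * \<beta>"
    by (subst witt_split[of \<alpha> N]) (rule distrib_right)
  also have "witt_restrict {..<N} \<alpha> * \<beta> =
      witt_restrict {..<N} \<alpha> * witt_restrict {..<N} \<beta> + witt_restrict {N..} \<beta> * witt_restrict {..<N} \<alpha>"
    by (subst witt_split[of \<beta> N]) (simp add: distrib_left mult.commute)
  finally show ?thesis
    using main by (simp add: gauss_below_add tail_mult_gauss_below)
qed

end

section \<open>Polynomials over a filtered ring\<close>

locale ring_filtration =
  fixes F :: "real \<Rightarrow> 'r::comm_ring_1 set"
  assumes zero: "0 \<in> F r"
    and antimono: "r \<le> s \<Longrightarrow> F s \<subseteq> F r"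
    and add: "x \<in> F r \<Longrightarrow> y \<in> F r \<Longrightarrow> x + y \<in> F r"
    and uminus: "x \<in> F r \<Longrightarrow> - x \<in> F r"
    and mult: "x \<in> F r \<Longrightarrow> y \<in> F s \<Longrightarrow> x * y \<in> F (r + s)"
begin

lemma diff: "x \<in> F r \<Longrightarrow> y \<in> F r \<Longrightarrow> x - y \<in> F r"
  using add[of x r "- y"] uminus[of y r] by simp

text \<open>Giving the variable degree \<open>r\<close>, the hypothesis says that all terms of \<open>h\<close> have degree at least \<open>s\<close>. The degree \<open>s\<close> must
vary in the induction, since dividing out the variable lowers it by \<open>r\<close>.\<close>

lemma poly_mem:
  assumes "x \<in> F r" "\<And>k. coeff h k \<in> F (s - real k * r)"
  shows "poly h x \<in> F s"
  using assms(2)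
proof (induction h arbitrary: s)
  case 0
  then show ?case by (simp add: zero)
next
  case (pCons c h)
  have "poly h x \<in> F (s - r)"
  proof (rule pCons.IH)
    show "coeff h k \<in> F (s - r - real k * r)" for k
      using pCons.prems[of "Suc k"] by (simp add: algebra_simps)
  qed
  then show ?case using mult[OF assms(1), of _ "s - r"] pCons.prems[of 0] by (auto intro: add)
qed

text \<open>Replacing one factor of degree \<open>r\<close> in a term by the difference \<open>x - y\<close> changes its degree by \<open>m - r\<close>. The constant
coefficient cancels, whence the restriction to \<open>k > 0\<close>.\<close>

lemma poly_diff_mem:
  assumes x: "x \<in> F r" and y: "y \<in> F r" and xy: "x - y \<in> F m"
    and h: "\<And>k. k > 0 \<Longrightarrow> coeff h k \<in> F (s - real k * r)"
  shows "poly h x - poly h y \<in> F (m + s - r)"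
  using h
proof (induction h arbitrary: s)
  case 0
  then show ?case by (simp add: zero)
next
  case (pCons c h)
  have h: "coeff h k \<in> F (s - r - real k * r)" for k
    using pCons.prems[of "Suc k"] by (simp add: algebra_simps)
  have "poly h x - poly h y \<in> F (m + (s - r) - r)"
    by (rule pCons.IH[OF h])
  then have "y * (poly h x - poly h y) \<in> F (m + s - r)"
    using mult[OF y] by fastforce
  moreover have "(x - y) * poly h x \<in> F (m + s - r)"
    using mult[OF xy poly_mem[OF x h]] by (simp add: algebra_simps)
  ultimately have "(x - y) * poly h x + y * (poly h x - poly h y) \<in> F (m + s - r)"
    by (intro add)
  then show ?case by (simp add: algebra_simps)
qed

end

sublocale witt_valuation \<subseteq> ring_filtration "gauss_ball \<nu> \<epsilon>"
proof
  show "gauss_ball \<nu> \<epsilon> s \<subseteq> gauss_ball \<nu> \<epsilon> r" if "r \<le> s" for r s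
    using that by (auto simp: gauss_ball_def intro: order_trans[rotated])
qed (auto simp: gauss_ball_eq intro: gauss_below_0 gauss_below_add gauss_below_uminus gauss_below_mult)

section \<open>The V-adic filtration and contractions\<close>

interpretation vadic: witt_valuation "trivial_val :: 'a::comm_ring_prime_char \<Rightarrow> ereal" 1
  by unfold_locales (simp_all add: proper_trivial)

abbreviation vadic :: "real \<Rightarrow> 'a::comm_ring_prime_char witt set" where
  "vadic \<equiv> gauss_ball trivial_val 1"

lemma mem_vadic_iff: "\<alpha> \<in> vadic r \<longleftrightarrow> (\<forall>i. real i < r \<longrightarrow> wcoeff \<alpha> i = 0)"
proof -
  have "0 < real (CHAR('a) ^ i)" for i
    using prime_gt_0_nat[OF CHAR_prime[where 'a = 'a]] by simp
  then have "ereal (real (CHAR('a) ^ i) * ((r - real i) / 1)) \<le> trivial_val (wcoeff \<alpha> i) \<longleftrightarrow>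
      (real i < r \<longrightarrow> wcoeff \<alpha> i = 0)" for i
    by (simp add: trivial_val_def mult_le_0_iff not_less del: of_nat_power)
  then show ?thesis by (simp only: vadic.mem_gauss_ball_iff)
qed

lemma vadic_nonpos: "r \<le> 0 \<Longrightarrow> \<alpha> \<in> vadic r"
  by (simp add: mem_vadic_iff)

lemma mem_vadic_1_iff: "\<alpha> \<in> vadic 1 \<longleftrightarrow> w0 \<alpha> = 0"
  by (auto simp: mem_vadic_iff w0_def)

lemma eq_0_if_vadic: "(\<And>n. \<alpha> \<in> vadic (real n)) \<Longrightarrow> \<alpha> = 0"
  by (rule witt_eqI) (metis wcoeff_0 mem_vadic_iff of_nat_less_iff lessI)

lemma vadic_diff_iff: "\<alpha> - \<beta> \<in> vadic (real m) \<longleftrightarrow> (\<forall>i<m. wcoeff \<alpha> i = wcoeff \<beta> i)"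
proof
  assume \<delta>: "\<alpha> - \<beta> \<in> vadic (real m)"
  \<comment> \<open>Adding a vector that vanishes below \<open>m\<close> to \<open>\<beta>\<close> only affects its tail, because the sum of head and new
      tail is computed componentwise; \<open>\<gamma>\<close> is that sum.\<close>
  define \<tau> where "\<tau> = witt_restrict {m..} \<beta> + (\<alpha> - \<beta>)"
  define \<gamma> where "\<gamma> = Witt (\<lambda>i. if i < m then wcoeff \<beta> i else wcoeff \<tau> i)"
  have \<tau>: "\<tau> \<in> vadic (real m)"
    unfolding \<tau>_def by (rule vadic.add[OF _ \<delta>]) (simp add: mem_vadic_iff wcoeff_restrict)
  have "\<alpha> = witt_restrict {..<m} \<beta> + witt_restrict {m..} \<beta> + (\<alpha> - \<beta>)"
    by (simp flip: witt_split)
  also have "\<dots> = witt_restrict {..<m} \<beta> + \<tau>"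
    by (simp add: \<tau>_def add.assoc)
  also have "witt_restrict {..<m} \<beta> = witt_restrict {..<m} \<gamma>"
    by (rule witt_eqI) (simp add: wcoeff_restrict \<gamma>_def)
  also have "\<tau> = witt_restrict {m..} \<gamma>"
    using \<tau> by (intro witt_eqI) (simp add: wcoeff_restrict \<gamma>_def mem_vadic_iff)
  also have "witt_restrict {..<m} \<gamma> + witt_restrict {m..} \<gamma> = \<gamma>"
    by (rule witt_split[symmetric])
  finally show "\<forall>i<m. wcoeff \<alpha> i = wcoeff \<beta> i"
    by (simp add: \<gamma>_def)
next
  assume "\<forall>i<m. wcoeff \<alpha> i = wcoeff \<beta> i"
  then have r: "witt_restrict {..<m} \<alpha> = witt_restrict {..<m} \<beta>"
    by (intro witt_eqI) (simp add: wcoeff_restrict)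
  have "\<alpha> - \<beta> = (witt_restrict {..<m} \<alpha> + witt_restrict {m..} \<alpha>)
      - (witt_restrict {..<m} \<beta> + witt_restrict {m..} \<beta>)"
    by (simp flip: witt_split)
  also have "\<dots> = witt_restrict {m..} \<alpha> - witt_restrict {m..} \<beta>"
    by (simp add: r)
  also have "\<dots> \<in> vadic (real m)"
    by (rule vadic.diff) (simp_all add: mem_vadic_iff wcoeff_restrict)
  finally show "\<alpha> - \<beta> \<in> vadic (real m)" .
qed

text \<open>The linear term gains one step because of its coefficient, all higher terms because the remaining factors
lie in \<open>VW(A)\<close>.\<close>

lemma vadic_contraction:
  assumes "coeff h 1 \<in> vadic 1" "x \<in> vadic 1" "y \<in> vadic 1" "x - y \<in> vadic r"
  shows "poly h x - poly h y \<in> vadic (r + 1)"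
proof -
  have "coeff h k \<in> vadic (2 - real k * 1)" if "k > 0" for k
    using that assms(1) by (cases "k = 1") (auto intro: vadic_nonpos)
  from vadic.poly_diff_mem[OF assms(2-4) this] have "poly h x - poly h y \<in> vadic (r + 2 - 1)" .
  moreover have "r + 2 - 1 = r + 1" by simp
  ultimately show ?thesis by (simp only:)
qed

lemma vadic_fixpoint_unique:
  assumes "coeff h 1 \<in> vadic 1" "x \<in> vadic 1" "y \<in> vadic 1" "poly h x = x" "poly h y = y"
  shows "x = y"
proof -
  have "x - y \<in> vadic (real n)" for n
  proof (induction n)
    case 0
    show ?case by (simp add: vadic_nonpos)
  next
    case (Suc n)
    from vadic_contraction[OF assms(1-3) this] show ?case
      by (simp add: assms add.commute)
  qed
  then show ?thesis using eq_0_if_vadic[of "x - y"] by simp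
qed

text \<open>The iterates of \<open>h\<close> starting at \<open>0\<close> remain in the ball, by \<open>poly_mem\<close>, and their \<open>i\<close>-th components are constant from the
\<open>i\<close>-th iterate on. Membership in the ball is tested componentwise, so the limit inherits it.\<close>

lemma (in witt_valuation) fixpoint_exists:
  assumes h0: "coeff h 0 \<in> vadic 1" and h1: "coeff h 1 \<in> vadic 1"
    and h: "\<And>k. coeff h k \<in> gauss_ball \<nu> \<epsilon> (r - real k * r)"
  shows "\<exists>x \<in> gauss_ball \<nu> \<epsilon> r \<inter> vadic 1. poly h x = x"
proof -
  define X where "X n = (poly h ^^ n) 0" for n
  have X_Suc: "X (Suc n) = poly h (X n)" for n
    by (simp add: X_def)
  have ball: "X n \<in> gauss_ball \<nu> \<epsilon> r" for n
    by (induction n) (auto simp: X_Suc intro: poly_mem[OF _ h], simp add: X_def zero)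
  \<comment> \<open>With the variable in degree \<open>1\<close>, this asks only the constant coefficient to lie in \<open>VW(A)\<close>.\<close>
  have "coeff h k \<in> vadic (1 - real k * 1)" for k
    using h0 by (cases "k = 0") (auto intro: vadic_nonpos)
  then have vad: "X n \<in> vadic 1" for n
    by (induction n) (auto simp: X_Suc intro: vadic.poly_mem, simp add: X_def vadic.zero)
  have step': "X (Suc n) - X n \<in> vadic (real (Suc n))" for n
  proof (induction n)
    case 0
    then show ?case using vad[of 1] by (simp add: X_def)
  next
    case (Suc n)
    from vadic_contraction[OF h1 vad vad this] show ?case
      by (simp add: X_Suc add.commute)
  qed
  have stable: "wcoeff (X n) i = wcoeff (X i) i" if "i \<le> n" for n i
    using that
  proof (induction n rule: dec_induct)
    case (step n)
    have "wcoeff (X (Suc n)) i = wcoeff (X n) i"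
      using step'[of n, unfolded vadic_diff_iff] step.hyps by (meson le_imp_less_Suc)
    with step.IH show ?case by simp
  qed simp
  define x where "x = Witt (\<lambda>i. wcoeff (X i) i)"
  have x_ball: "x \<in> gauss_ball \<nu> \<epsilon> r"
    using ball by (simp add: mem_gauss_ball_iff x_def)
  have x_vad: "x \<in> vadic 1"
    by (simp add: mem_vadic_iff x_def X_def wcoeff_0)
  have approx: "x - X n \<in> vadic (real (Suc n))" for n
    unfolding vadic_diff_iff by (auto simp: x_def intro: stable[symmetric])
  have "poly h x - x \<in> vadic (real n)" for n
  proof -
    have "poly h x - poly h (X n) \<in> vadic (real n)"
      using vadic_contraction[OF h1 x_vad vad approx] by (rule subsetD[OF vadic.antimono, rotated]) simp
    moreover have "x - X (Suc n) \<in> vadic (real n)"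
      using approx by (rule subsetD[OF vadic.antimono, rotated]) simp
    ultimately have "(poly h x - poly h (X n)) - (x - X (Suc n)) \<in> vadic (real n)"
      by (rule vadic.diff)
    then show ?thesis by (simp add: X_Suc)
  qed
  then have "poly h x = x" using eq_0_if_vadic[of "poly h x - x"] by simp
  with x_ball x_vad show ?thesis by blast
qed

text \<open>As \<open>u [b] = 1 - v\<close> with \<open>v\<close> in \<open>VW(A)\<close>, the equation \<open>u x = 0\<close> gives \<open>x = v x\<close>, and multiplication by \<open>v\<close> raises the V-adic
order.\<close>

lemma unit_cancel:
  assumes "w0 u * b = 1" "u * x = 0"
  shows "x = 0"
proof -
  define v where "v = 1 - u * vteich 0 b"
  have "w0 v = 0"
    using assms(1)
    by (simp add: v_def hom_diff[OF is_ring_hom_w0] hom_mult[OF is_ring_hom_w0] hom_1[OF is_ring_hom_w0])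
       (simp add: w0_def wcoeff_vteich)
  then have v: "v \<in> vadic 1" by (simp add: mem_vadic_1_iff)
  have "v * x = x - vteich 0 b * (u * x)" by (simp add: v_def algebra_simps)
  then have vx: "v * x = x" by (simp add: assms)
  have "x \<in> vadic (real n)" for n
  proof (induction n)
    case 0
    show ?case by (simp add: vadic_nonpos)
  next
    case (Suc n)
    from vadic.mult[OF v this] show ?case by (simp add: vx)
  qed
  then show ?thesis by (rule eq_0_if_vadic)
qed

section \<open>Overconvergence\<close>

lemma overconvergentI:
  assumes "\<epsilon> > 0" "\<alpha> \<in> gauss_ball \<nu> \<epsilon> r"
  shows "\<alpha> \<in> overconvergent_witt \<nu>"
proof -
  from assms(2) have "witt_gauss \<nu> \<epsilon> \<alpha> \<noteq> - \<infinity>"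
    by (auto simp: gauss_ball_def)
  with assms(1) show ?thesis
    by (auto simp: overconvergent_witt_def overconvergent_radius_def)
qed

lemma overconvergentE:
  assumes "\<alpha> \<in> overconvergent_witt \<nu>"
  obtains \<epsilon> r where "\<epsilon> > 0" "\<alpha> \<in> gauss_ball \<nu> \<epsilon> r"
proof -
  from assms obtain \<epsilon> where e: "\<epsilon> > 0" "witt_gauss \<nu> \<epsilon> \<alpha> \<noteq> - \<infinity>"
    by (auto simp: overconvergent_witt_def overconvergent_radius_def)
  then obtain r where "ereal r \<le> witt_gauss \<nu> \<epsilon> \<alpha>"
    by (cases "witt_gauss \<nu> \<epsilon> \<alpha>") auto
  with e that show ?thesis by (auto simp: gauss_ball_def)
qed

context
  fixes \<nu> :: "'a::comm_ring_prime_char \<Rightarrow> ereal"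
  assumes \<nu>: "proper_pseudovaluation \<nu>"
begin

text \<open>The bound on the value of the \<open>i\<close>-th component known at some \<open>\<epsilon>\<^sub>1\<close> becomes stronger than required at \<open>\<epsilon>\<close> once \<open>\<delta>/\<epsilon>\<close> exceeds the
deficit \<open>(\<bar>r\<bar> + j)/\<epsilon>\<^sub>1\<close>, uniformly in \<open>i \<ge> j\<close>: the summand \<open>i\<close> in the Gauss norm is not scaled
with \<open>\<epsilon>\<close>, whereas the values are.\<close>

lemma eventually_gauss_ball:
  assumes \<alpha>: "\<alpha> \<in> overconvergent_witt \<nu>" and vad: "\<alpha> \<in> vadic (real j)" and \<delta>: "\<delta> > 0"
  shows "\<forall>\<^sub>F \<epsilon> in at_right 0. \<alpha> \<in> gauss_ball \<nu> \<epsilon> (real j - \<delta>)"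
proof -
  from \<alpha> obtain \<epsilon>\<^sub>1 r where e1: "\<epsilon>\<^sub>1 > 0" and r: "\<alpha> \<in> gauss_ball \<nu> \<epsilon>\<^sub>1 r"
    by (rule overconvergentE)
  interpret e1: witt_valuation \<nu> \<epsilon>\<^sub>1 by unfold_locales (fact \<nu> e1)+
  define \<epsilon>\<^sub>0 where "\<epsilon>\<^sub>0 = min \<epsilon>\<^sub>1 (\<epsilon>\<^sub>1 * \<delta> / (\<bar>r\<bar> + real j + 1))"
  have e0: "\<epsilon>\<^sub>0 > 0" using e1 \<delta> by (simp add: \<epsilon>\<^sub>0_def)
  have "\<alpha> \<in> gauss_ball \<nu> \<epsilon> (real j - \<delta>)" if e: "0 < \<epsilon>" "\<epsilon> < \<epsilon>\<^sub>0" for \<epsilon>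
  proof -
    interpret e: witt_valuation \<nu> \<epsilon> by unfold_locales (fact \<nu> e)+
    show ?thesis unfolding e.mem_gauss_ball_iff
    proof
      fix i
      show "ereal (real (CHAR('a) ^ i) * ((real j - \<delta> - real i) / \<epsilon>)) \<le> \<nu> (wcoeff \<alpha> i)"
      proof (cases "i < j")
        case True
        with vad show ?thesis by (simp add: mem_vadic_iff val_0[OF \<nu>])
      next
        case False
        have "\<epsilon> * (\<bar>r\<bar> + real j + 1) \<le> \<epsilon>\<^sub>1 * \<delta>"
          using e by (simp add: \<epsilon>\<^sub>0_def pos_less_divide_eq)
        then have "(\<bar>r\<bar> + real j) / \<epsilon>\<^sub>1 \<le> \<delta> / \<epsilon>"
          using e e1 by (simp add: field_simps)
        moreover have "(real i - real j) / \<epsilon>\<^sub>1 \<le> (real i - real j) / \<epsilon>"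
          using e e1 False by (intro divide_left_mono) (auto simp: \<epsilon>\<^sub>0_def)
        moreover have "(real i - r) / \<epsilon>\<^sub>1 \<le> (real i - real j) / \<epsilon>\<^sub>1 + (\<bar>r\<bar> + real j) / \<epsilon>\<^sub>1"
          unfolding add_divide_distrib[symmetric] using e1 by (intro divide_right_mono) auto
        ultimately have "(real j - \<delta> - real i) / \<epsilon> \<le> (r - real i) / \<epsilon>\<^sub>1"
          by (simp add: diff_divide_distrib)
        then have "real (CHAR('a) ^ i) * ((real j - \<delta> - real i) / \<epsilon>) \<le> real (CHAR('a) ^ i) * ((r - real i) / \<epsilon>\<^sub>1)"
          by (rule mult_left_mono) simp
        also have "ereal \<dots> \<le> \<nu> (wcoeff \<alpha> i)"
          using r by (simp only: e1.mem_gauss_ball_iff)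
        finally show ?thesis by simp
      qed
    qed
  qed
  then show ?thesis
    using e0 unfolding eventually_at_right_field by blast
qed

lemma overconvergent_common_ball:
  assumes "\<alpha> \<in> overconvergent_witt \<nu>" "\<beta> \<in> overconvergent_witt \<nu>"
  obtains \<epsilon> where "\<epsilon> > 0" "\<alpha> \<in> gauss_ball \<nu> \<epsilon> (- 1)" "\<beta> \<in> gauss_ball \<nu> \<epsilon> (- 1)"
proof -
  have "\<forall>\<^sub>F \<epsilon> in at_right 0. \<alpha> \<in> gauss_ball \<nu> \<epsilon> (- 1)" "\<forall>\<^sub>F \<epsilon> in at_right 0. \<beta> \<in> gauss_ball \<nu> \<epsilon> (- 1)"
    using eventually_gauss_ball[OF assms(1), of 0 1] eventually_gauss_ball[OF assms(2), of 0 1]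
    by (simp_all add: vadic_nonpos)
  then have "\<forall>\<^sub>F \<epsilon> in at_right 0. \<epsilon> > 0 \<and> \<alpha> \<in> gauss_ball \<nu> \<epsilon> (- 1) \<and> \<beta> \<in> gauss_ball \<nu> \<epsilon> (- 1)"
    using eventually_at_right_less[of "0::real"] by eventually_elim blast
  from eventually_happens[OF this] that show ?thesis by auto
qed

lemma overconvergent_add: "\<alpha> \<in> overconvergent_witt \<nu> \<Longrightarrow> \<beta> \<in> overconvergent_witt \<nu> \<Longrightarrow> \<alpha> + \<beta> \<in> overconvergent_witt \<nu>"
  and overconvergent_diff: "\<alpha> \<in> overconvergent_witt \<nu> \<Longrightarrow> \<beta> \<in> overconvergent_witt \<nu> \<Longrightarrow> \<alpha> - \<beta> \<in> overconvergent_witt \<nu>"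
  and overconvergent_mult: "\<alpha> \<in> overconvergent_witt \<nu> \<Longrightarrow> \<beta> \<in> overconvergent_witt \<nu> \<Longrightarrow> \<alpha> * \<beta> \<in> overconvergent_witt \<nu>"
proof -
  assume "\<alpha> \<in> overconvergent_witt \<nu>" "\<beta> \<in> overconvergent_witt \<nu>"
  then obtain \<epsilon> where e: "\<epsilon> > 0" and mem: "\<alpha> \<in> gauss_ball \<nu> \<epsilon> (- 1)" "\<beta> \<in> gauss_ball \<nu> \<epsilon> (- 1)"
    by (rule overconvergent_common_ball)
  interpret witt_valuation \<nu> \<epsilon> by unfold_locales (fact \<nu> e)+
  show "\<alpha> + \<beta> \<in> overconvergent_witt \<nu>" "\<alpha> - \<beta> \<in> overconvergent_witt \<nu>" "\<alpha> * \<beta> \<in> overconvergent_witt \<nu>"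
    using overconvergentI[OF e] add[OF mem] diff[OF mem] mult[OF mem] by blast+
qed

lemma overconvergent_vteich: "vteich 0 a \<in> overconvergent_witt \<nu>"
proof -
  obtain r where r: "ereal r \<le> \<nu> a"
    using val_not_minf[OF \<nu>, of a] by (cases "\<nu> a") auto
  interpret witt_valuation \<nu> 1 by unfold_locales (simp_all add: \<nu>)
  from r have "vteich 0 a \<in> gauss_ball \<nu> 1 r"
    by (simp add: mem_gauss_ball_iff wcoeff_vteich val_0[OF \<nu>])
  then show ?thesis by (rule overconvergentI[rotated]) simp
qed

lemma overconvergent_0: "0 \<in> overconvergent_witt \<nu>"
  using overconvergent_diff[OF overconvergent_vteich[of 0] overconvergent_vteich[of 0]] by simp

lemma overconvergent_1: "1 \<in> overconvergent_witt \<nu>"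
proof -
  have "vteich 0 1 = (1 :: 'a witt)" by (simp add: vteich_def one_witt_def)
  then show ?thesis using overconvergent_vteich[of 1] by simp
qed

lemma overconvergent_pcompose_shift:
  assumes "\<And>k. coeff f k \<in> overconvergent_witt \<nu>" and c: "c \<in> overconvergent_witt \<nu>"
  shows "coeff (pcompose f [:c, 1:]) k \<in> overconvergent_witt \<nu>"
  using assms(1)
proof (induction f arbitrary: k)
  case 0
  then show ?case by (simp add: overconvergent_0)
next
  case (pCons b f)
  have b: "b \<in> overconvergent_witt \<nu>" using pCons.prems[of 0] by simp
  have "coeff f k \<in> overconvergent_witt \<nu>" for k
    using pCons.prems[of "Suc k"] by simp
  note IH = pCons.IH[OF this]
  show ?case
    using IH[of 0]
    by (cases k) (auto simp: pcompose_pCons intro!: overconvergent_add overconvergent_mult b c IH overconvergent_0)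
qed

end

section \<open>Hensel's lemma\<close>

lemma formal_deriv_pCons: "formal_deriv (pCons c f) = f + pCons 0 (formal_deriv f)"
proof (rule poly_eqI)
  fix n show "coeff (formal_deriv (pCons c f)) n = coeff (f + pCons 0 (formal_deriv f)) n"
    by (cases n) (simp_all add: coeff_formal_deriv algebra_simps)
qed

text \<open>The first two terms of the Taylor expansion of \<open>f\<close> at \<open>c\<close>.\<close>

lemma pcompose_shift_coeffs:
  fixes f :: "'r::comm_ring_1 poly"
  shows "coeff (pcompose f [:c, 1:]) 0 = poly f c" "coeff (pcompose f [:c, 1:]) 1 = poly (formal_deriv f) c"
proof -
  show 0: "coeff (pcompose f [:c, 1:]) 0 = poly f c" for f :: "'r poly"
    by (induction f) (simp_all add: pcompose_pCons)
  show "coeff (pcompose f [:c, 1:]) 1 = poly (formal_deriv f) c"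
    by (induction f) (simp_all add: pcompose_pCons formal_deriv_pCons 0, simp add: formal_deriv_def)
qed

lemma poly_map_poly_hom:
  assumes "is_ring_hom h"
  shows "h (poly f c) = poly (map_poly h f) (h c)"
proof (induction f)
  case 0
  then show ?case by (simp add: hom_0[OF assms])
next
  case (pCons a f)
  then show ?case
    by (simp add: map_poly_pCons hom_0[OF assms] hom_add[OF assms] hom_mult[OF assms])
qed

lemma map_poly_formal_deriv:
  assumes "is_ring_hom h"
  shows "map_poly h (formal_deriv f) = formal_deriv (map_poly h f)"
  by (rule poly_eqI)
     (simp add: coeff_map_poly hom_0[OF assms] coeff_formal_deriv hom_mult[OF assms] hom_of_nat[OF assms] del: of_nat_Suc)

theorem proposition2p30:
  fixes p :: nat
    and \<iota> :: "'k::field \<Rightarrow> 'a::comm_ring_prime_char"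
    and \<nu> :: "'a \<Rightarrow> ereal"
    and f :: "'a witt poly"
    and a :: 'a
  assumes "prime p" and "CHAR('k) = p"
    and "\<forall>c::'k. \<exists>b. b ^ p = c"
    and "finitely_generated_algebra \<iota>"
    and "admissible \<iota> \<nu>"
    and "\<forall>i. coeff f i \<in> overconvergent_witt \<nu>"
    and "poly (map_poly w0 f) a = 0"
    and "poly (formal_deriv (map_poly w0 f)) a dvd 1"
  shows "\<exists>!\<alpha>. \<alpha> \<in> overconvergent_witt \<nu> \<and> poly f \<alpha> = 0 \<and> w0 \<alpha> = a"
proof -
  have \<nu>: "proper_pseudovaluation \<nu>"
    using assms(5) by (simp add: admissible_def negative_pseudovaluation_def)
  note w0 = is_ring_hom_w0[where 'a = 'a]
  obtain b where b: "b * poly (formal_deriv (map_poly w0 f)) a = 1"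
    using assms(8) by (metis dvdE mult.commute)
  define c where "c = vteich 0 a"
  define u where "u = vteich 0 b"
  define g where "g = pcompose f [:c, 1:]"
  define h where "h = [:0, 1:] - smult u g"
  have w0_c: "w0 c = a" and w0_u: "w0 u = b"
    by (simp_all add: c_def u_def w0_def wcoeff_vteich)
  have poly_g: "poly g x = poly f (c + x)" for x
    by (simp add: g_def poly_pcompose)
  have fixpoint: "poly h x = x \<longleftrightarrow> poly f (c + x) = 0" for x
  proof -
    have "w0 u * poly (formal_deriv (map_poly w0 f)) a = 1" by (simp add: w0_u b)
    then have "u * poly g x = 0 \<longleftrightarrow> poly g x = 0" using unit_cancel[of u _ "poly g x"] by auto
    then show ?thesis by (simp add: h_def poly_g)
  qed
  have "w0 (coeff h 0) = 0" "w0 (coeff h 1) = 0"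
    using assms(7) b unfolding h_def g_def coeff_diff coeff_smult pcompose_shift_coeffs
    by (simp_all add: hom_diff[OF w0] hom_mult[OF w0] hom_0[OF w0] hom_1[OF w0] poly_map_poly_hom[OF w0]
        map_poly_formal_deriv[OF w0] w0_c w0_u hom_uminus[OF w0])
  then have h01: "coeff h 0 \<in> vadic 1" "coeff h 1 \<in> vadic 1"
    by (simp_all add: mem_vadic_1_iff)
  have c: "c \<in> overconvergent_witt \<nu>"
    by (simp add: c_def overconvergent_vteich[OF \<nu>])
  have h: "coeff h k \<in> overconvergent_witt \<nu>" for k
    unfolding h_def coeff_diff coeff_smult g_def
  proof (intro overconvergent_diff[OF \<nu>] overconvergent_mult[OF \<nu>] overconvergent_pcompose_shift[OF \<nu>] c)
    show "coeff [:0, 1:] k \<in> overconvergent_witt \<nu>"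
      by (auto simp: coeff_pCons overconvergent_0[OF \<nu>] overconvergent_1[OF \<nu>] split: nat.split)
  qed (use assms(6) in \<open>simp_all add: u_def overconvergent_vteich[OF \<nu>]\<close>)
  have "\<forall>\<^sub>F \<epsilon> in at_right 0. coeff h k \<in> gauss_ball \<nu> \<epsilon> (1/2 - real k * (1/2))" for k
  proof -
    \<comment> \<open>The coefficients with \<open>k = 0\<close> and \<open>k = 1\<close> lie in \<open>VW(A)\<close> and reach \<open>1/2\<close>; the others are needed only in a ball
      of index at most \<open>- 1/2\<close>.\<close>
    define j :: nat where "j = (if k \<le> 1 then 1 else 0)"
    have "coeff h k \<in> vadic (real j)"
      using h01 by (auto simp: j_def vadic_nonpos le_Suc_eq)
    from eventually_gauss_ball[OF \<nu> h this, of "1/2"]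
    have "\<forall>\<^sub>F \<epsilon> in at_right 0. coeff h k \<in> gauss_ball \<nu> \<epsilon> (real j - 1/2)" by simp
    then show ?thesis
    proof eventually_elim
      case (elim \<epsilon>)
      have "1/2 - real k * (1/2) \<le> real j - 1/2" by (auto simp: j_def)
      with elim show ?case by (auto simp: gauss_ball_def intro: order_trans[rotated])
    qed
  qed
  then have "\<forall>\<^sub>F \<epsilon> in at_right 0. \<forall>k\<in>{..degree h}. coeff h k \<in> gauss_ball \<nu> \<epsilon> (1/2 - real k * (1/2))"
    by (intro eventually_ball_finite) auto
  then have "\<forall>\<^sub>F \<epsilon> in at_right 0. \<epsilon> > 0 \<and> (\<forall>k\<in>{..degree h}. coeff h k \<in> gauss_ball \<nu> \<epsilon> (1/2 - real k * (1/2)))"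
    using eventually_at_right_less[of "0::real"] by eventually_elim blast
  from eventually_happens[OF this] obtain \<epsilon> where \<epsilon>: "\<epsilon> > 0"
    and ball: "\<And>k. k \<le> degree h \<Longrightarrow> coeff h k \<in> gauss_ball \<nu> \<epsilon> (1/2 - real k * (1/2))"
    by auto
  interpret witt_valuation \<nu> \<epsilon> by unfold_locales (fact \<nu> \<epsilon>)+
  have "coeff h k \<in> gauss_ball \<nu> \<epsilon> (1/2 - real k * (1/2))" for k
    using ball[of k] by (cases "k \<le> degree h") (auto simp: coeff_eq_0 zero)
  from fixpoint_exists[OF h01 this] obtain x where
    x: "x \<in> gauss_ball \<nu> \<epsilon> (1/2)" "x \<in> vadic 1" "poly h x = x" by blast
  show ?thesis
  proof (rule ex1I[of _ "c + x"])
    show "c + x \<in> overconvergent_witt \<nu> \<and> poly f (c + x) = 0 \<and> w0 (c + x) = a"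
      using x overconvergentI[OF \<epsilon> x(1)] c
      by (simp add: fixpoint overconvergent_add[OF \<nu>] hom_add[OF w0] w0_c mem_vadic_1_iff)
  next
    fix \<alpha> assume \<alpha>: "\<alpha> \<in> overconvergent_witt \<nu> \<and> poly f \<alpha> = 0 \<and> w0 \<alpha> = a"
    then have "\<alpha> - c \<in> vadic 1" "poly h (\<alpha> - c) = \<alpha> - c"
      by (simp_all add: fixpoint mem_vadic_1_iff hom_diff[OF w0] w0_c)
    then have "\<alpha> - c = x"
      using vadic_fixpoint_unique[OF h01(2)] x by blast
    then show "\<alpha> = c + x" by (simp add: algebra_simps)
  qed
qed

end
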